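(* Let $T>0$ and let $v,b$ be vector fields such that $u=v+b$ and $h=v-b$ belong to $L^\infty(0,T;L^2(\mathbb{T}^3))\cap L^3(0,T;L^3(\mathbb{T}^3))$ and form a weak solution on $(0,T)\times\mathbb{T}^3$ of $$u_t+h\cdot\nabla u+\nabla\Pi=0,\qquad h_t+u\cdot\nabla h+\nabla\Pi=0,\qquad \mathrm{div}\,u=\mathrm{div}\,h=0.$$ Let $D_E(v,b)=\lim_{\varepsilon\to0}D_E(v,b;\varepsilon)$ and $D_{CH}(v,b)=\lim_{\varepsilon\to0}D_{CH}(v,b;\varepsilon)$, where $$D_E(v,b;\varepsilon)=-\frac14\int_{\mathbb{T}^3}\nabla\varphi_\varepsilon(\ell)\cdot\delta v(\ell)\big(|\delta v(\ell)|^2+|\delta b(\ell)|^2\big)d\ell+\frac12\int_{\mathbb{T}^3}\nabla\varphi_\varepsilon(\ell)\cdot\delta b(\ell)\,\big(\delta v(\ell)\cdot\delta b(\ell)\big)d\ell,$$ $$D_{CH}(v,b;\varepsilon)=-\frac12\int_{\mathbb{T}^3}\nabla\varphi_\varepsilon(\ell)\cdot\delta v(\ell)\,\big(\delta v(\ell)\cdot\delta b(\ell)\big)d\ell+\frac14\int_{\mathbb{T}^3}\nabla\varphi_\varepsilon(\ell)\cdot\delta b(\ell)\big(|\delta v(\ell)|^2+|\delta b(\ell)|^2\big)d\ell,$$ and let $S_1,\dots,S_6$ be the limits (presupposed to exist) $$S_1(v,v,v)=-\lim_{\lambda\to0}\frac1\lambda\int_{\partial B}\ell\cdot\delta v(\lambda\ell)|\delta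 v(\lambda\ell)|^2\frac{d\sigma(\ell)}{4\pi},\qquad S_2(v,b,b)=-\lim_{\lambda\to0}\frac1\lambda\int_{\partial B}\ell\cdot\delta v(\lambda\ell)|\delta b(\lambda\ell)|^2\frac{d\sigma(\ell)}{4\pi},$$ $$S_3(b,v,b)=-\lim_{\lambda\to0}\frac1\lambda\int_{\partial B}\ell\cdot\delta b(\lambda\ell)\,\big(\delta v(\lambda\ell)\cdot\delta b(\lambda\ell)\big)\frac{d\sigma(\ell)}{4\pi},\qquad S_4(v,v,b)=-\lim_{\lambda\to0}\frac1\lambda\int_{\partial B}\ell\cdot\delta v(\lambda\ell)\,\big(\delta v(\lambda\ell)\cdot\delta b(\lambda\ell)\big)\frac{d\sigma(\ell)}{4\pi},$$ $$S_5(b,v,v)=-\lim_{\lambda\to0}\frac1\lambda\int_{\partial B}\ell\cdot\delta b(\lambda\ell)|\delta v(\lambda\ell)|^2\frac{d\sigma(\ell)}{4\pi},\qquad S_6(b,b,b)=-\lim_{\lambda\to0}\frac1\lambda\int_{\partial B}\ell\cdot\delta b(\lambda\ell)|\delta b(\lambda\ell)|^2\frac{d\sigma(\ell)}{4\pi}.$$ Then $$S_1(v,v,v)+S_2(v,b,b)-2S_3(b,v,b)=-\frac43D_E(v,b),\qquad 2S_4(v,v,b)-S_5(b,v,v)-S_6(b,b,b)=-\frac43D_{CH}(v,b).$$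
   Context: $\mathbb{T}^3$ is the three-dimensional torus (functions are extended periodically). For a function $f=f(x,t)$ and $\ell\in\mathbb{R}^3$, $\delta f(\ell)=f(x+\ell,t)-f(x,t)$, regarded as a function of $(x,t)$. $\varphi(x)=C_0e^{-1/(1-|x|^2)}$ for $|x|<1$, $\varphi(x)=0$ for $|x|\ge1$, is the standard mollifier with $\int_{\mathbb{R}^3}\varphi\,dx=1$, and $\varphi_\varepsilon(x)=\varepsilon^{-3}\varphi(x/\varepsilon)$. $\partial B=\{x\in\mathbb{R}^3:|x|=1\}$ and $\sigma$ is its surface measure. Weak solution means that the equations hold in the sense of distributions, with nonlinear terms in divergence form, i.e. $(h\cdot\nabla u)_j=\partial_i(h_iu_j)$, $(u\cdot\nabla h)_j=\partial_i(u_ih_j)$, for a scalar pressure $\Pi$. Limits as $\varepsilon\to0$ and $\lambda\to0$ are in the sense of distributions on $(0,T)\times\mathbb{T}^3$. *)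

theory Defs
  imports "HOL-Analysis.Analysis"
begin

text \<open>
  Space-time points are pairs \<open>(x, t)\<close>. The torus is \<open>\<real>\<^sup>3\<close> modulo the integer lattice, with the
  fundamental cell \<open>[-1/2, 1/2]\<^sup>3\<close>; functions on it are functions on \<open>\<real>\<^sup>3\<close> of period 1 in each
  coordinate. Centring the cell at 0 makes it contain the support of the mollifier at scale
  \<open>\<epsilon>\<close> for all \<open>\<epsilon> \<le> 1/2\<close>.
\<close>

type_synonym spacetime = "(real^3) \<times> real"

definition torus_cell :: "(real^3) set" where
  "torus_cell = cbox (\<chi> i. -1/2) (\<chi> i. 1/2)"

definition periodic_on :: "real \<Rightarrow> (spacetime \<Rightarrow> 'a) \<Rightarrow> bool" where
  "periodic_on T f \<longleftrightarrow> (\<forall>x. \<forall>t\<in>{0<..<T}. \<forall>i. f (x + axis i 1, t) = f (x, t))"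


subsection \<open>Test functions and distributions on the space-time cylinder\<close>

definition dt :: "(spacetime \<Rightarrow> real) \<Rightarrow> spacetime \<Rightarrow> real" where
  "dt \<psi> z = frechet_derivative \<psi> (at z) (0, 1)"

definition dx :: "3 \<Rightarrow> (spacetime \<Rightarrow> real) \<Rightarrow> spacetime \<Rightarrow> real" where
  "dx i \<psi> z = frechet_derivative \<psi> (at z) (axis i 1, 0)"

fun iterated_partial :: "'a::euclidean_space list \<Rightarrow> ('a \<Rightarrow> real) \<Rightarrow> 'a \<Rightarrow> real" where
  "iterated_partial [] f = f"
| "iterated_partial (e # es) f = (\<lambda>x. frechet_derivative (iterated_partial es f) (at x) e)"

definition smooth :: "('a::euclidean_space \<Rightarrow> real) \<Rightarrow> bool" where
  "smooth f \<longleftrightarrow> (\<forall>es. set es \<subseteq> Basis \<longrightarrow> iterated_partial es f differentiable_on UNIV)"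

text \<open>Smooth functions on the torus times \<open>\<real>\<close>, supported in the times \<open>[a, c]\<close>.\<close>

definition smooth_supported :: "real \<Rightarrow> real \<Rightarrow> (spacetime \<Rightarrow> real) set" where
  "smooth_supported a c = {\<psi>. smooth \<psi> \<and> (\<forall>x t i. \<psi> (x + axis i 1, t) = \<psi> (x, t)) \<and>
      (\<forall>x t. t \<notin> {a..c} \<longrightarrow> \<psi> (x, t) = 0)}"

definition test_functions :: "real \<Rightarrow> (spacetime \<Rightarrow> real) set" where
  "test_functions T = (\<Union>a\<in>{0<..<T}. \<Union>c\<in>{0<..<T}. smooth_supported a c)"

text \<open>
  A distribution is a linear functional on test functions obeying, for each compact set
  \<open>[a, c]\<close> of times, a bound by finitely many derivatives. Its values off the test functions carry
  no meaning, so equality of distributions is equality on \<open>test_functions T\<close>.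
\<close>

definition is_distribution :: "real \<Rightarrow> ((spacetime \<Rightarrow> real) \<Rightarrow> real) \<Rightarrow> bool" where
  "is_distribution T \<Lambda> \<longleftrightarrow>
     (\<forall>\<psi>\<in>test_functions T. \<forall>\<eta>\<in>test_functions T. \<Lambda> (\<lambda>z. \<psi> z + \<eta> z) = \<Lambda> \<psi> + \<Lambda> \<eta>) \<and>
     (\<forall>\<psi>\<in>test_functions T. \<forall>r. \<Lambda> (\<lambda>z. r * \<psi> z) = r * \<Lambda> \<psi>) \<and>
     (\<forall>a\<in>{0<..<T}. \<forall>c\<in>{0<..<T}. \<exists>C N. \<forall>\<psi>\<in>smooth_supported a c. \<forall>M.
        (\<forall>es z. set es \<subseteq> Basis \<and> length es \<le> N \<longrightarrow> \<bar>iterated_partial es \<psi> z\<bar> \<le> M)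
        \<longrightarrow> \<bar>\<Lambda> \<psi>\<bar> \<le> C * M)"

definition pairing :: "real \<Rightarrow> (spacetime \<Rightarrow> real) \<Rightarrow> (spacetime \<Rightarrow> real) \<Rightarrow> real" where
  "pairing T f \<psi> = (LINT z:torus_cell \<times> {0<..<T}|lborel. f z * \<psi> z)"

text \<open>
  Convergence of functions \<open>F \<epsilon>\<close> to \<open>\<Lambda>\<close> in the sense of distributions as \<open>\<epsilon>\<close> decreases to 0. The
  integrability clause says that \<open>F \<epsilon>\<close> can be paired with every test function, since the
  Bochner integral of a non-integrable function is 0.
\<close>

definition distr_limit ::
    "real \<Rightarrow> (real \<Rightarrow> spacetime \<Rightarrow> real) \<Rightarrow> ((spacetime \<Rightarrow> real) \<Rightarrow> real) \<Rightarrow> bool" where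
  "distr_limit T F \<Lambda> \<longleftrightarrow> is_distribution T \<Lambda> \<and>
     (\<forall>\<^sub>F \<epsilon> in at_right 0. \<forall>\<psi>\<in>test_functions T.
        set_integrable lborel (torus_cell \<times> {0<..<T}) (\<lambda>z. F \<epsilon> z * \<psi> z)) \<and>
     (\<forall>\<psi>\<in>test_functions T. ((\<lambda>\<epsilon>. pairing T (F \<epsilon>) \<psi>) \<longlongrightarrow> \<Lambda> \<psi>) (at_right 0))"


subsection \<open>Function spaces and weak solutions\<close>

text \<open>
  Elements of the Lebesgue spaces are represented by Borel measurable functions that are periodic
  everywhere; every equivalence class has such a representative.
\<close>

definition torus_field :: "real \<Rightarrow> (spacetime \<Rightarrow> real^3) \<Rightarrow> bool" where
  "torus_field T f \<longleftrightarrow> periodic_on T f \<and>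
     f \<in> borel_measurable (restrict_space borel (UNIV \<times> {0<..<T}))"

definition Linf_L2 :: "real \<Rightarrow> (spacetime \<Rightarrow> real^3) set" where
  "Linf_L2 T = {f. torus_field T f \<and> (\<exists>C::real. AE t in lborel. t \<in> {0<..<T} \<longrightarrow>
      (\<integral>\<^sup>+x\<in>torus_cell. ennreal (norm (f (x, t)) ^ 2) \<partial>lborel) \<le> ennreal C)}"

definition L3_L3 :: "real \<Rightarrow> (spacetime \<Rightarrow> real^3) set" where
  "L3_L3 T = {f. torus_field T f \<and>
      (\<integral>\<^sup>+t\<in>{0<..<T}. (\<integral>\<^sup>+x\<in>torus_cell. ennreal (norm (f (x, t)) ^ 3) \<partial>lborel) \<partial>lborel) < \<infinity>}"

text \<open>
  Distributional form of \<open>u\<^sub>t + div (h \<otimes> u) + \<nabla>P = 0\<close>, tested componentwise, with the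
  pressure \<open>P\<close> a scalar distribution.
\<close>

definition weak_transport :: "real \<Rightarrow> (spacetime \<Rightarrow> real^3) \<Rightarrow> (spacetime \<Rightarrow> real^3) \<Rightarrow>
    ((spacetime \<Rightarrow> real) \<Rightarrow> real) \<Rightarrow> bool" where
  "weak_transport T u h P \<longleftrightarrow> (\<forall>\<psi>\<in>test_functions T. \<forall>j.
     - pairing T (\<lambda>z. u z $ j) (dt \<psi>)
     - (\<Sum>i\<in>UNIV. pairing T (\<lambda>z. h z $ i * u z $ j) (dx i \<psi>))
     - P (dx j \<psi>) = 0)"

definition weak_divergence_free :: "real \<Rightarrow> (spacetime \<Rightarrow> real^3) \<Rightarrow> bool" where
  "weak_divergence_free T u \<longleftrightarrow> (\<forall>\<psi>\<in>test_functions T.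
     - (\<Sum>i\<in>UNIV. pairing T (\<lambda>z. u z $ i) (dx i \<psi>)) = 0)"

definition weak_solution :: "real \<Rightarrow> (spacetime \<Rightarrow> real^3) \<Rightarrow> (spacetime \<Rightarrow> real^3) \<Rightarrow>
    ((spacetime \<Rightarrow> real) \<Rightarrow> real) \<Rightarrow> bool" where
  "weak_solution T u h P \<longleftrightarrow> is_distribution T P \<and>
     weak_transport T u h P \<and> weak_transport T h u P \<and>
     weak_divergence_free T u \<and> weak_divergence_free T h"


subsection \<open>Mollifier, increments and surface averages\<close>

definition bump :: "real^3 \<Rightarrow> real" where
  "bump x = (if norm x < 1 then exp (- 1 / (1 - (norm x)\<^sup>2)) else 0)"

definition std_mollifier :: "real^3 \<Rightarrow> real" where
  "std_mollifier x = (1 / (LINT y|lborel. bump y)) * bump x"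

definition mollifier :: "real \<Rightarrow> real^3 \<Rightarrow> real" where
  "mollifier \<epsilon> x = std_mollifier (x /\<^sub>R \<epsilon>) / \<epsilon> ^ 3"

definition grad :: "(real^3 \<Rightarrow> real) \<Rightarrow> real^3 \<Rightarrow> real^3" where
  "grad f x = (\<chi> i. frechet_derivative f (at x) (axis i 1))"

definition incr :: "(spacetime \<Rightarrow> real^3) \<Rightarrow> real^3 \<Rightarrow> spacetime \<Rightarrow> real^3" where
  "incr f l = (\<lambda>(x, t). f (x + l, t) - f (x, t))"

text \<open>
  Surface measure of the unit sphere: \<open>\<sigma>(A)\<close> is 3 times the volume of the cone
  \<open>{r\<omega>. 0 < r < 1, \<omega> \<in> A}\<close> over \<open>A\<close>, so that the whole sphere has measure \<open>4\<pi>\<close>. It is a measure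
  on \<open>\<real>\<^sup>3\<close> concentrated on the sphere (\<open>sgn x\<close> is the radial projection \<open>x / |x|\<close>).
\<close>

definition surface_measure :: "(real^3) measure" where
  "surface_measure = distr (density lborel (\<lambda>x. 3 * indicator (ball 0 1) x)) borel sgn"

definition D_E_eps ::
    "(spacetime \<Rightarrow> real^3) \<Rightarrow> (spacetime \<Rightarrow> real^3) \<Rightarrow> real \<Rightarrow> spacetime \<Rightarrow> real" where
  "D_E_eps v b \<epsilon> z =
     - (1/4) * (LINT l:torus_cell|lborel. (grad (mollifier \<epsilon>) l \<bullet> incr v l z) *
                  ((norm (incr v l z))\<^sup>2 + (norm (incr b l z))\<^sup>2))
     + (1/2) * (LINT l:torus_cell|lborel. (grad (mollifier \<epsilon>) l \<bullet> incr b l z) *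
                  (incr v l z \<bullet> incr b l z))"

definition D_CH_eps ::
    "(spacetime \<Rightarrow> real^3) \<Rightarrow> (spacetime \<Rightarrow> real^3) \<Rightarrow> real \<Rightarrow> spacetime \<Rightarrow> real" where
  "D_CH_eps v b \<epsilon> z =
     - (1/2) * (LINT l:torus_cell|lborel. (grad (mollifier \<epsilon>) l \<bullet> incr v l z) *
                  (incr v l z \<bullet> incr b l z))
     + (1/4) * (LINT l:torus_cell|lborel. (grad (mollifier \<epsilon>) l \<bullet> incr b l z) *
                  ((norm (incr v l z))\<^sup>2 + (norm (incr b l z))\<^sup>2))"

text \<open>
  The six structure functions are all instances of one trilinear average at scale \<open>r\<close>, with
  \<open>|\<delta>f|\<^sup>2\<close> written as \<open>\<delta>f \<bullet> \<delta>f\<close>. The minus sign in front of the limits is included.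
\<close>

definition S_avg :: "(spacetime \<Rightarrow> real^3) \<Rightarrow> (spacetime \<Rightarrow> real^3) \<Rightarrow> (spacetime \<Rightarrow> real^3) \<Rightarrow>
    real \<Rightarrow> spacetime \<Rightarrow> real" where
  "S_avg f g k r z = - (1 / r) * (LINT l:sphere 0 1|surface_measure.
     (l \<bullet> incr f (r *\<^sub>R l) z) * (incr g (r *\<^sub>R l) z \<bullet> incr k (r *\<^sub>R l) z) / (4 * pi))"

end

theory Submission
  imports Defs
begin

text \<open>
  Both identities compare two ways of averaging a flux \<open>V l z\<close>, cubic in the increments of \<open>v\<close> and
  \<open>b\<close>: the mean over spheres \<open>|l| = r\<close>, which gives the structure functions, and the mean against
  \<open>\<nabla>\<phi>\<^sub>\<epsilon>(l)\<close>, which gives \<open>D_E\<close> and \<open>D_CH\<close>. The mollifier is radial, so \<open>\<nabla>\<phi>\<^sub>\<epsilon>(l) = Q\<^sub>\<epsilon>(|l|) l\<close> with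
  \<open>Q\<^sub>\<epsilon> \<le> 0\<close> supported in \<open>[0, \<epsilon>]\<close>. In polar coordinates the second mean therefore becomes a weighted
  average of the first over radii: writing \<open>p r\<close> for the pairing of the sphere mean at
  radius \<open>r\<close> with a fixed test function,
  \<open>\<integral> \<nabla>\<phi>\<^sub>\<epsilon> \<bullet> V = \<integral> w\<^sub>\<epsilon> r * p r dr\<close> (after pairing), where \<open>w\<^sub>\<epsilon> r = - 4 \<pi> r\<^sup>4 Q\<^sub>\<epsilon> r\<close>.

  The weight \<open>w\<^sub>\<epsilon>\<close> is nonnegative, lives on \<open>(0, \<epsilon>)\<close>, and has total mass 3. The mass is an integration by
  parts: \<open>- \<integral> l \<bullet> \<nabla>\<phi> = 3 \<integral> \<phi> = 3\<close>. So whenever the sphere means of a flux converge, the mollified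
  fluxes converge to 3 times the same limit (\<open>mollified_flux_limit\<close>). Combining the fluxes with the
  coefficients \<open>-1/4\<close>, \<open>1/2\<close> of \<open>D_E\<close> gives \<open>D_E = - 3/4 (S\<^sub>1 + S\<^sub>2 - 2 S\<^sub>3)\<close>, and \<open>D_CH\<close> is analogous.

  The exchanges of integrals rest on one estimate: for a field in \<open>L\<^sup>3\<close> the
  \<open>L\<^sup>3\<close> norm of the increment over the space-time cell is bounded uniformly in \<open>|l| \<le> 1\<close>, because the
  translated cell is covered by finitely many periods (\<open>increment_cube_bound\<close>). Products of three
  increments are then uniformly integrable in space-time (\<open>integrable_trilinear_flux\<close>), and
  Fubini's theorem applies for every finite mass of displacements (\<open>integrable_flux_Fubini\<close>).
\<close>

section \<open>Polar coordinates in three dimensions\<close>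

lemma sets_surface_measure [simp, measurable_cong]: "sets surface_measure = sets borel"
  by (simp add: surface_measure_def)

lemma space_surface_measure [simp]: "space surface_measure = UNIV"
  by (simp add: surface_measure_def)

lemma borel_unit_ball [measurable]: "ball (0::real^3) 1 \<in> sets borel"
  by simp

lemma nn_integral_surface_measure:
  assumes [measurable]: "G \<in> borel_measurable borel"
  shows "(\<integral>\<^sup>+w. G w \<partial>surface_measure) =
    (\<integral>\<^sup>+y. ennreal (3 * indicator (ball 0 1) y) * G (sgn y) \<partial>lborel)"
proof -
  have "(\<integral>\<^sup>+w. G w \<partial>surface_measure) = (\<integral>\<^sup>+y. 3 * indicator (ball 0 1) y * G (sgn y) \<partial>lborel)"
    unfolding surface_measure_def by (subst nn_integral_distr, simp_all, subst nn_integral_density) simp_all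
  then show ?thesis
    by (simp add: ennreal_mult' ennreal_indicator)
qed

lemma emeasure_surface_measure:
  "emeasure surface_measure UNIV = 3 * emeasure lborel (ball (0::real^3) 1)"
proof -
  have "emeasure surface_measure UNIV =
      (\<integral>\<^sup>+y. 3 * indicator (ball 0 1) y \<partial>(lborel :: (real^3) measure))"
    using nn_integral_surface_measure[of "\<lambda>_. 1"]
    by (simp add: ennreal_indicator[symmetric] ennreal_mult')
  then show ?thesis
    by (simp add: nn_integral_cmult_indicator)
qed

lemma finite_measure_surface_measure: "finite_measure surface_measure"
proof (rule finite_measureI)
  have "emeasure surface_measure UNIV < \<infinity>"
    unfolding emeasure_surface_measure
    using emeasure_bounded_finite[OF bounded_ball, of "0::real^3" 1] by (simp add: ennreal_mult_less_top)
  then show "emeasure surface_measure (space surface_measure) \<noteq> \<infinity>" by simp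
qed

interpretation surface: finite_measure surface_measure
  by (rule finite_measure_surface_measure)

lemma AE_surface_measure_sphere: "AE w in surface_measure. w \<in> sphere 0 1"
proof -
  have "AE y in lborel. y \<noteq> (0::real^3)"
    by (rule AE_lborel_singleton)
  then show ?thesis
    unfolding surface_measure_def
    by (subst AE_distr_iff) (simp_all add: norm_sgn AE_density)
qed

lemma nn_integral_lborel_scale:
  fixes F :: "real^3 \<Rightarrow> ennreal"
  assumes [measurable]: "F \<in> borel_measurable borel" and "s > 0"
  shows "(\<integral>\<^sup>+y. F (s *\<^sub>R y) \<partial>lborel) = ennreal (1 / s ^ 3) * (\<integral>\<^sup>+x. F x \<partial>lborel)"
proof -
  have "(\<integral>\<^sup>+x. F x \<partial>lborel) = ennreal (s ^ 3) * (\<integral>\<^sup>+y. F (s *\<^sub>R y) \<partial>lborel)"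
    using \<open>s > 0\<close>
    by (subst lborel_affine[of s 0])
      (simp_all add: nn_integral_density nn_integral_distr nn_integral_cmult ennreal_power)
  then show ?thesis
    using \<open>s > 0\<close> by (simp add: mult.assoc[symmetric] ennreal_mult[symmetric])
qed

text \<open>
  The radial weight left over when a point is rescaled out of the cone that defines the surface
  measure; that it integrates to 1 is what makes the constant 3 in that definition the right one.
\<close>

lemma polar_radial_integral:
  fixes a :: real
  assumes "a > 0"
  shows "(\<integral>\<^sup>+s. ennreal (indicator {a<..} s * (3 * a ^ 3 / s ^ 4)) \<partial>lborel) = 1"
proof -
  have "(\<integral>\<^sup>+s. ennreal (indicator {a<..} s * (3 * a ^ 3 / s ^ 4)) \<partial>lborel) =
      (\<integral>\<^sup>+s. ennreal (3 * a ^ 3 / s ^ 4) * indicator {a..} s \<partial>lborel)"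
    by (rule nn_integral_cong_AE, use AE_lborel_singleton[of a] in eventually_elim)
      (auto simp: indicator_def)
  also have "\<dots> = ennreal (0 - (- (a ^ 3 / a ^ 3)))"
  proof (rule nn_integral_FTC_atLeast[where F="\<lambda>s. - (a ^ 3 / s ^ 3)"])
    fix x assume "a \<le> x"
    then have "x > 0" using assms by simp
    then show "((\<lambda>s. - (a ^ 3 / s ^ 3)) has_real_derivative 3 * a ^ 3 / x ^ 4) (at x)"
      by (auto intro!: derivative_eq_intros simp: divide_simps) (simp add: power_numeral_reduce)?
    show "0 \<le> 3 * a ^ 3 / x ^ 4" using assms by simp
  next
    have "((\<lambda>s::real. - (a ^ 3) / s ^ 3) \<longlongrightarrow> 0) at_top"
      by (rule tendsto_divide_0[OF tendsto_const filterlim_at_top_imp_at_infinity])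
        (simp add: filterlim_pow_at_top filterlim_ident)
    then show "((\<lambda>s. - (a ^ 3 / s ^ 3)) \<longlongrightarrow> 0) at_top" by simp
  qed measurable
  also have "\<dots> = 1" using assms by simp
  finally show ?thesis .
qed

text \<open>
  The surface integral on the right is a volume integral over \<open>y\<close> in the unit ball. On the ray through
  \<open>y\<close>, substitute \<open>r = s |y|\<close>; for fixed \<open>s\<close>, substitute \<open>x = s y\<close>. Tonelli's theorem then leaves, for each
  \<open>x\<close>, the factor \<open>\<integral> 3 |x|\<^sup>3 / s\<^sup>4 ds\<close> over \<open>s > |x|\<close>, which is 1.
\<close>

lemma nn_integral_polar:
  fixes F :: "real^3 \<Rightarrow> ennreal"
  assumes [measurable]: "F \<in> borel_measurable borel"
  shows "(\<integral>\<^sup>+x. F x \<partial>lborel) =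
    (\<integral>\<^sup>+r. \<integral>\<^sup>+w. ennreal (indicator {0<..} r * r\<^sup>2) * F (r *\<^sub>R w) \<partial>surface_measure \<partial>lborel)"
proof -
  \<comment> \<open>The change of variables along a ray; the exponent 3 is \<open>|y|\<^sup>2\<close> from \<open>r\<^sup>2\<close> and \<open>|y|\<close> from \<open>dr\<close>.\<close>
  have ray: "(\<integral>\<^sup>+r. ennreal (indicator {0<..} r * r\<^sup>2) * F (r *\<^sub>R sgn y) \<partial>lborel) =
      (\<integral>\<^sup>+s. ennreal (indicator {0<..} s * s\<^sup>2 * norm y ^ 3) * F (s *\<^sub>R y) \<partial>lborel)"
    if "y \<noteq> 0" for y
  proof -
    have "(\<integral>\<^sup>+r. ennreal (indicator {0<..} r * r\<^sup>2) * F (r *\<^sub>R sgn y) \<partial>lborel) =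
        ennreal (norm y) * (\<integral>\<^sup>+s. ennreal (indicator {0<..} (norm y * s) * (norm y * s)\<^sup>2) *
          F ((norm y * s) *\<^sub>R sgn y) \<partial>lborel)"
      using that by (subst nn_integral_real_affine[where c="norm y" and t=0]) auto
    also have "\<dots> = (\<integral>\<^sup>+s. ennreal (norm y) * (ennreal (indicator {0<..} (norm y * s) * (norm y * s)\<^sup>2) *
          F ((norm y * s) *\<^sub>R sgn y)) \<partial>lborel)"
      by (rule nn_integral_cmult[symmetric]) measurable
    also have "\<dots> = (\<integral>\<^sup>+s. ennreal (indicator {0<..} s * s\<^sup>2 * norm y ^ 3) * F (s *\<^sub>R y) \<partial>lborel)"
    proof (rule nn_integral_cong)
      fix s :: real
      have "(norm y * s) *\<^sub>R sgn y = s *\<^sub>R y"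
        using that by (simp add: sgn_div_norm)
      moreover have "norm y * (indicator {0<..} (norm y * s) * (norm y * s)\<^sup>2) =
          indicator {0<..} s * s\<^sup>2 * norm y ^ 3"
        using that by (simp add: indicator_def zero_less_mult_iff power_mult_distrib
          power2_eq_square power3_eq_cube)
      ultimately show "ennreal (norm y) * (ennreal (indicator {0<..} (norm y * s) * (norm y * s)\<^sup>2) *
          F ((norm y * s) *\<^sub>R sgn y)) =
          ennreal (indicator {0<..} s * s\<^sup>2 * norm y ^ 3) * F (s *\<^sub>R y)"
        by (simp add: mult.assoc[symmetric] ennreal_mult[symmetric])
    qed
    finally show ?thesis .
  qed
  have shell: "(\<integral>\<^sup>+y. ennreal (3 * indicator (ball 0 1) y) *
        (ennreal (indicator {0<..} s * s\<^sup>2 * norm y ^ 3) * F (s *\<^sub>R y)) \<partial>lborel) =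
      (\<integral>\<^sup>+x. ennreal (indicator {norm x<..} s * (3 * norm x ^ 3 / s ^ 4)) * F x \<partial>lborel)" for s
  proof (cases "s > 0")
    case True
    have "(\<integral>\<^sup>+y. ennreal (3 * indicator (ball 0 1) y) *
          (ennreal (indicator {0<..} s * s\<^sup>2 * norm y ^ 3) * F (s *\<^sub>R y)) \<partial>lborel) =
        (\<integral>\<^sup>+y. ennreal (3 * indicator {..<s} (norm (s *\<^sub>R y)) * norm (s *\<^sub>R y) ^ 3 / s) *
          F (s *\<^sub>R y) \<partial>lborel)"
    proof (rule nn_integral_cong)
      fix y :: "real^3"
      have "norm (s *\<^sub>R y) \<in> {..<s} \<longleftrightarrow> y \<in> ball 0 1"
        using True by simp
      then have "3 * indicator (ball 0 1) y * (indicator {0<..} s * s\<^sup>2 * norm y ^ 3) =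
          3 * indicator {..<s} (norm (s *\<^sub>R y)) * norm (s *\<^sub>R y) ^ 3 / s"
        using True
        by (simp add: indicator_def power_mult_distrib power2_eq_square power3_eq_cube)
      then show "ennreal (3 * indicator (ball 0 1) y) *
          (ennreal (indicator {0<..} s * s\<^sup>2 * norm y ^ 3) * F (s *\<^sub>R y)) =
          ennreal (3 * indicator {..<s} (norm (s *\<^sub>R y)) * norm (s *\<^sub>R y) ^ 3 / s) * F (s *\<^sub>R y)"
        by (simp add: mult.assoc[symmetric] ennreal_mult[symmetric])
    qed
    also have "\<dots> = ennreal (1 / s ^ 3) *
        (\<integral>\<^sup>+x. ennreal (3 * indicator {..<s} (norm x) * norm x ^ 3 / s) * F x \<partial>lborel)"
      by (rule nn_integral_lborel_scale[OF _ True]) measurable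
    also have "\<dots> = (\<integral>\<^sup>+x. ennreal (1 / s ^ 3) *
        (ennreal (3 * indicator {..<s} (norm x) * norm x ^ 3 / s) * F x) \<partial>lborel)"
      by (rule nn_integral_cmult[symmetric]) measurable
    also have "\<dots> = (\<integral>\<^sup>+x. ennreal (indicator {norm x<..} s * (3 * norm x ^ 3 / s ^ 4)) * F x \<partial>lborel)"
    proof (rule nn_integral_cong)
      fix x :: "real^3"
      have "1 / s ^ 3 * (3 * indicator {..<s} (norm x) * norm x ^ 3 / s) =
          indicator {norm x<..} s * (3 * norm x ^ 3 / s ^ 4)"
        using True by (simp add: indicator_def power_numeral_reduce)
      then show "ennreal (1 / s ^ 3) * (ennreal (3 * indicator {..<s} (norm x) * norm x ^ 3 / s) * F x) =
          ennreal (indicator {norm x<..} s * (3 * norm x ^ 3 / s ^ 4)) * F x"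
        using True by (simp add: mult.assoc[symmetric] ennreal_mult[symmetric])
    qed
    finally show ?thesis .
  next
    case False
    then have "indicator {norm x<..} s = (0::real)" for x :: "real^3"
      using norm_ge_zero[of x] by (auto simp: indicator_def simp del: norm_ge_zero)
    with False show ?thesis by simp
  qed
  have "(\<integral>\<^sup>+r. \<integral>\<^sup>+w. ennreal (indicator {0<..} r * r\<^sup>2) * F (r *\<^sub>R w) \<partial>surface_measure \<partial>lborel) =
      (\<integral>\<^sup>+r. \<integral>\<^sup>+y. ennreal (3 * indicator (ball 0 1) y) *
        (ennreal (indicator {0<..} r * r\<^sup>2) * F (r *\<^sub>R sgn y)) \<partial>lborel \<partial>lborel)"
    by (subst nn_integral_surface_measure) measurable
  also have "\<dots> = (\<integral>\<^sup>+y. \<integral>\<^sup>+r. ennreal (3 * indicator (ball 0 1) y) *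
        (ennreal (indicator {0<..} r * r\<^sup>2) * F (r *\<^sub>R sgn y)) \<partial>lborel \<partial>lborel)"
    by (rule lborel_pair.Fubini') measurable
  also have "\<dots> = (\<integral>\<^sup>+y. \<integral>\<^sup>+s. ennreal (3 * indicator (ball 0 1) y) *
        (ennreal (indicator {0<..} s * s\<^sup>2 * norm y ^ 3) * F (s *\<^sub>R y)) \<partial>lborel \<partial>lborel)"
    by (rule nn_integral_cong_AE, use AE_lborel_singleton[of 0] in eventually_elim)
      (simp add: nn_integral_cmult ray)
  also have "\<dots> = (\<integral>\<^sup>+s. \<integral>\<^sup>+y. ennreal (3 * indicator (ball 0 1) y) *
        (ennreal (indicator {0<..} s * s\<^sup>2 * norm y ^ 3) * F (s *\<^sub>R y)) \<partial>lborel \<partial>lborel)"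
    by (rule lborel_pair.Fubini'[symmetric]) measurable
  also have "\<dots> = (\<integral>\<^sup>+s. \<integral>\<^sup>+x. ennreal (indicator {norm x<..} s * (3 * norm x ^ 3 / s ^ 4)) * F x
        \<partial>lborel \<partial>lborel)"
    by (simp only: shell)
  also have "\<dots> = (\<integral>\<^sup>+x. \<integral>\<^sup>+s. ennreal (indicator {norm x<..} s * (3 * norm x ^ 3 / s ^ 4)) * F x
        \<partial>lborel \<partial>lborel)"
    unfolding greaterThan_def
    by (rule lborel_pair.Fubini') measurable
  also have "\<dots> = (\<integral>\<^sup>+x. F x \<partial>lborel)"
    by (rule nn_integral_cong_AE, use AE_lborel_singleton[of 0] in eventually_elim)
      (simp add: nn_integral_multc polar_radial_integral del: times_divide_eq_right)
  finally show ?thesis ..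
qed

text \<open>
  Stated as an equality of measures, the formula transfers to Bochner integrals, where the signs of the
  integrand may cancel.
\<close>

lemma lborel_polar:
  "(lborel :: (real^3) measure) =
    distr (density (lborel \<Otimes>\<^sub>M surface_measure) (\<lambda>p. ennreal (indicator {0<..} (fst p) * (fst p)\<^sup>2))) borel
      (\<lambda>p. fst p *\<^sub>R snd p)"
proof (rule measure_eqI)
  let ?D = "density (lborel \<Otimes>\<^sub>M surface_measure)
      (\<lambda>p. ennreal (indicator {0<..} (fst p) * (fst p)\<^sup>2))"
  fix A :: "(real^3) set" assume "A \<in> sets lborel"
  then have [measurable]: "A \<in> sets borel" by simp
  have m: "(\<lambda>p. ennreal (indicator {0<..} (fst p) * (fst p)\<^sup>2) * indicator A (fst p *\<^sub>R snd p))
      \<in> borel_measurable (lborel \<Otimes>\<^sub>M surface_measure)"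
    by measurable
  have "emeasure lborel A = (\<integral>\<^sup>+x. indicator A x \<partial>lborel)" by simp
  also have "\<dots> = (\<integral>\<^sup>+p. ennreal (indicator {0<..} (fst p) * (fst p)\<^sup>2) * indicator A (fst p *\<^sub>R snd p)
      \<partial>(lborel \<Otimes>\<^sub>M surface_measure))"
    using surface.nn_integral_fst[OF m] by (subst nn_integral_polar) auto
  also have "\<dots> = (\<integral>\<^sup>+p. indicator A (fst p *\<^sub>R snd p) \<partial>?D)"
    by (rule nn_integral_density[symmetric]) measurable
  also have "\<dots> = (\<integral>\<^sup>+x. indicator A x \<partial>distr ?D borel (\<lambda>p. fst p *\<^sub>R snd p))"
    by (rule nn_integral_distr[symmetric]) measurable
  finally show "emeasure lborel A = emeasure (distr ?D borel (\<lambda>p. fst p *\<^sub>R snd p)) A"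
    by simp
qed simp

interpretation polar: pair_sigma_finite "lborel :: real measure" surface_measure ..

lemma integral_polar:
  fixes F :: "real^3 \<Rightarrow> real"
  assumes F: "integrable lborel F"
  shows "integrable lborel (\<lambda>r. indicator {0<..} r * r\<^sup>2 * (\<integral>w. F (r *\<^sub>R w) \<partial>surface_measure))"
    and "(\<integral>x. F x \<partial>lborel) =
      (\<integral>r. indicator {0<..} r * r\<^sup>2 * (\<integral>w. F (r *\<^sub>R w) \<partial>surface_measure) \<partial>lborel)"
proof -
  have [measurable]: "F \<in> borel_measurable borel" using F by simp
  let ?G = "\<lambda>p. indicator {0<..} (fst p) * (fst p)\<^sup>2 * F (fst p *\<^sub>R snd p)"
  let ?D = "density (lborel \<Otimes>\<^sub>M surface_measure)
      (\<lambda>p. ennreal (indicator {0<..} (fst p) * (fst p)\<^sup>2))"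
  have "integrable (distr ?D borel (\<lambda>p. fst p *\<^sub>R snd p)) F"
    using F lborel_polar by simp
  then have "integrable ?D (\<lambda>p. F (fst p *\<^sub>R snd p))"
    by (rule integrable_distr_eq[THEN iffD1, rotated 2]) measurable
  moreover have m: "(\<lambda>p. F (fst p *\<^sub>R snd p)) \<in> borel_measurable (lborel \<Otimes>\<^sub>M surface_measure)"
    "(\<lambda>p. indicator {0<..} (fst p) * (fst p)\<^sup>2 :: real) \<in> borel_measurable (lborel \<Otimes>\<^sub>M surface_measure)"
    by measurable
  ultimately have int: "integrable (lborel \<Otimes>\<^sub>M surface_measure) ?G"
    using integrable_density[OF m] by simp
  show "integrable lborel (\<lambda>r. indicator {0<..} r * r\<^sup>2 * (\<integral>w. F (r *\<^sub>R w) \<partial>surface_measure))"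
    using polar.integrable_fst'[OF int] by simp
  have "(\<integral>x. F x \<partial>lborel) = (\<integral>p. F (fst p *\<^sub>R snd p) \<partial>?D)"
    by (subst lborel_polar, rule integral_distr) measurable
  also have "\<dots> = (\<integral>p. ?G p \<partial>(lborel \<Otimes>\<^sub>M surface_measure))"
    using integral_density[OF m] by simp
  also have "\<dots> = (\<integral>r. indicator {0<..} r * r\<^sup>2 * (\<integral>w. F (r *\<^sub>R w) \<partial>surface_measure) \<partial>lborel)"
    using polar.integral_fst'[OF int] by simp
  finally show "(\<integral>x. F x \<partial>lborel) =
      (\<integral>r. indicator {0<..} r * r\<^sup>2 * (\<integral>w. F (r *\<^sub>R w) \<partial>surface_measure) \<partial>lborel)" .
qed

section \<open>The radial profile of the mollifier and its gradient\<close>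

text \<open>
  The profile, written \<open>B\<close> in the comments, takes the squared norm, so that the mollifier is a composition
  of differentiable maps even at the origin.
\<close>

definition bump_profile :: "real \<Rightarrow> real" where
  "bump_profile s = (if s < 1 then exp (- 1 / (1 - s)) else 0)"

definition bump_profile_deriv :: "real \<Rightarrow> real" where
  "bump_profile_deriv s = (if s < 1 then - exp (- 1 / (1 - s)) / (1 - s)\<^sup>2 else 0)"

lemma bump_eq_profile: "bump x = bump_profile (x \<bullet> x)"
  by (simp add: bump_def bump_profile_def power2_norm_eq_inner[symmetric] abs_square_less_1)

lemma borel_measurable_bump_profile [measurable]:
  "bump_profile \<in> borel_measurable borel" "bump_profile_deriv \<in> borel_measurable borel"
  unfolding bump_profile_def[abs_def] bump_profile_deriv_def[abs_def] by measurable

text \<open>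
  Quadratic flatness at 0 yields two facts at the edge of the bump at once: the profile is
  differentiable there, and its derivative stays bounded.
\<close>

lemma exp_flat: "exp (- 1 / x) \<le> 2 * x\<^sup>2" if "x > 0" for x :: real
proof -
  have "(1 / x)\<^sup>2 / 2 \<le> exp (1 / x)"
    using exp_lower_Taylor_quadratic[of "1 / x"] that by (smt (verit) divide_nonneg_nonneg)
  then have "1 \<le> exp (1 / x) * (2 * x\<^sup>2)"
    using that by (simp add: field_simps power_divide)
  then have "exp (- (1 / x)) * 1 \<le> exp (- (1 / x)) * (exp (1 / x) * (2 * x\<^sup>2))"
    by (rule mult_left_mono) simp
  also have "\<dots> = 2 * x\<^sup>2"
    by (simp add: mult.assoc[symmetric] exp_add[symmetric])
  finally show ?thesis by simp
qed

lemma bump_profile_bounds: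
  "bump_profile_deriv s \<le> 0" "- 2 \<le> bump_profile_deriv s"
  "\<bar>bump_profile s\<bar> \<le> 2 * (s - 1)\<^sup>2"
  using exp_flat[of "1 - s"]
  by (auto simp: bump_profile_def bump_profile_deriv_def divide_simps power2_commute)

lemma bump_profile_has_derivative:
  "(bump_profile has_real_derivative bump_profile_deriv s) (at s)"
proof -
  consider "s < 1" | "s > 1" | "s = 1" by linarith
  then show ?thesis
  proof cases
    case 1
    have "((\<lambda>s. exp (- 1 / (1 - s))) has_real_derivative bump_profile_deriv s) (at s)"
      using 1 by (auto intro!: derivative_eq_intros simp: bump_profile_deriv_def power2_eq_square)
    then show ?thesis
      by (rule has_field_derivative_transform_within_open[where S="{..<1}"])
        (use 1 in \<open>auto simp: bump_profile_def\<close>)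
  next
    case 2
    have "((\<lambda>s. 0) has_real_derivative bump_profile_deriv s) (at s)"
      using 2 by (simp add: bump_profile_deriv_def)
    then show ?thesis
      by (rule has_field_derivative_transform_within_open[where S="{1<..}"])
        (use 2 in \<open>auto simp: bump_profile_def\<close>)
  next
    case 3
    have "((\<lambda>y. bump_profile y / (y - 1)) \<longlongrightarrow> 0) (at 1)"
    proof (rule tendsto_0_le[where K=2])
      show "((\<lambda>y::real. y - 1) \<longlongrightarrow> 0) (at 1)"
        by (intro tendsto_eq_intros) auto
      show "\<forall>\<^sub>F y in at 1. norm (bump_profile y / (y - 1)) \<le> norm (y - 1) * 2"
      proof (rule eventuallyI)
        fix y
        have "\<bar>bump_profile y\<bar> \<le> \<bar>y - 1\<bar> * 2 * \<bar>y - 1\<bar>"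
          using bump_profile_bounds(3)[of y] by (simp add: power2_eq_square abs_mult[symmetric])
        then show "norm (bump_profile y / (y - 1)) \<le> norm (y - 1) * 2"
          by (cases "y = 1") (auto simp: divide_simps)
      qed
    qed
    then show ?thesis
      using 3 by (simp add: has_field_derivative_iff bump_profile_def bump_profile_deriv_def)
  qed
qed

definition bump_mass :: real where
  "bump_mass = (\<integral>y. bump y \<partial>lborel)"

text \<open>
  The factor \<open>Q\<^sub>\<epsilon>\<close> in \<open>\<nabla>\<phi>\<^sub>\<epsilon>(l) = Q\<^sub>\<epsilon>(|l|) l\<close>. The exponent 5 collects \<open>\<epsilon>\<^sup>3\<close> from the normalisation
  and \<open>\<epsilon>\<^sup>2\<close> from differentiating \<open>|l|\<^sup>2 / \<epsilon>\<^sup>2\<close>.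
\<close>

definition grad_profile :: "real \<Rightarrow> real \<Rightarrow> real" where
  "grad_profile \<epsilon> r = 2 / (bump_mass * \<epsilon> ^ 5) * bump_profile_deriv ((r / \<epsilon>)\<^sup>2)"

lemma mollifier_eq_profile:
  "mollifier \<epsilon> x = bump_profile ((norm x / \<epsilon>)\<^sup>2) / (bump_mass * \<epsilon> ^ 3)"
proof -
  have "(x /\<^sub>R \<epsilon>) \<bullet> (x /\<^sub>R \<epsilon>) = (norm x / \<epsilon>)\<^sup>2"
    by (simp add: power2_norm_eq_inner[symmetric] power_divide divide_inverse
        power_mult_distrib power_inverse)
  then show ?thesis
    by (simp add: mollifier_def std_mollifier_def bump_mass_def bump_eq_profile)
qed

lemma grad_mollifier:
  assumes "\<epsilon> > 0"
  shows "grad (mollifier \<epsilon>) x = grad_profile \<epsilon> (norm x) *\<^sub>R x"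
proof -
  have D: "(mollifier \<epsilon> has_derivative
      (\<lambda>h. bump_profile_deriv ((norm x / \<epsilon>)\<^sup>2) * (2 * (x \<bullet> h) / \<epsilon>\<^sup>2) / (bump_mass * \<epsilon> ^ 3))) (at x)"
  proof -
    have eq: "mollifier \<epsilon> = (\<lambda>x. bump_profile ((x \<bullet> x) / \<epsilon>\<^sup>2) / (bump_mass * \<epsilon> ^ 3))"
      by (rule ext) (simp add: mollifier_eq_profile power_divide power2_norm_eq_inner)
    have inner: "((\<lambda>x. (x \<bullet> x) / \<epsilon>\<^sup>2) has_derivative (\<lambda>h. 2 * (x \<bullet> h) / \<epsilon>\<^sup>2)) (at x)"
      using assms by (auto intro!: derivative_eq_intros simp: inner_commute divide_simps)
    have "((\<lambda>x. bump_profile ((x \<bullet> x) / \<epsilon>\<^sup>2)) has_derivative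
        (\<lambda>h. (2 * (x \<bullet> h) / \<epsilon>\<^sup>2) * bump_profile_deriv ((x \<bullet> x) / \<epsilon>\<^sup>2))) (at x)"
      by (rule has_derivative_compose[OF inner
            bump_profile_has_derivative[THEN has_field_derivative_imp_has_derivative, THEN has_derivative_eq_rhs]])
        (simp add: fun_eq_iff)
    then show ?thesis
      unfolding eq
      by (rule has_derivative_eq_rhs[OF bounded_linear.has_derivative[OF bounded_linear_divide]])
        (simp add: power_divide power2_norm_eq_inner fun_eq_iff ac_simps)
  qed
  show ?thesis
    unfolding grad_def frechet_derivative_at[OF D, symmetric]
    by (simp add: vec_eq_iff grad_profile_def inner_axis power_numeral_reduce mult_ac)
qed

lemma integrable_bump: "integrable lborel bump"
proof -
  have [measurable]: "bump \<in> borel_measurable borel"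
    by (subst bump_eq_profile[abs_def]) measurable
  show ?thesis
  proof (rule Bochner_Integration.integrable_bound[OF _ _ AE_I2])
    show "integrable lborel (indicator (ball (0::real^3) 1) :: _ \<Rightarrow> real)"
      using emeasure_bounded_finite[OF bounded_ball] by (simp add: integrable_indicator_iff)
    show "norm (bump x) \<le> norm (indicator (ball 0 1) x :: real)" for x
      by (auto simp: bump_def indicator_def abs_square_le_1 less_imp_le)
  qed measurable
qed

lemma bump_mass_pos: "bump_mass > 0"
proof -
  have "bump_mass \<noteq> 0"
  proof
    assume "bump_mass = 0"
    then have "AE x in lborel. bump x = 0"
      unfolding bump_mass_def
      by (subst (asm) integral_nonneg_eq_0_iff_AE[OF integrable_bump]) (auto simp: bump_def)
    then have "AE x in lborel. x \<notin> ball (0::real^3) 1"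
      by eventually_elim (auto simp: bump_def)
    then have "emeasure lborel (ball (0::real^3) 1) = 0"
      by (subst (asm) AE_iff_measurable[where N="ball (0::real^3) 1"]) auto
    then show False
      by (simp add: emeasure_ball unit_ball_vol_3)
  qed
  moreover have "bump_mass \<ge> 0"
    unfolding bump_mass_def by (rule Bochner_Integration.integral_nonneg) (auto simp: bump_def)
  ultimately show ?thesis by simp
qed

lemma grad_profile_nonpos: "\<epsilon> > 0 \<Longrightarrow> grad_profile \<epsilon> r \<le> 0"
  using bump_mass_pos bump_profile_bounds(1)[of "(r / \<epsilon>)\<^sup>2"]
  unfolding grad_profile_def by (intro mult_nonneg_nonpos) auto

lemma grad_profile_bounded:
  assumes "\<epsilon> > 0"
  shows "\<bar>grad_profile \<epsilon> r\<bar> \<le> 4 / (bump_mass * \<epsilon> ^ 5)"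
  using assms bump_mass_pos bump_profile_bounds(1,2)[of "(r / \<epsilon>)\<^sup>2"]
  by (auto simp: grad_profile_def abs_mult abs_if field_simps)

lemma grad_profile_outside:
  assumes "\<epsilon> > 0" "r \<ge> \<epsilon>"
  shows "grad_profile \<epsilon> r = 0"
proof -
  have "1 \<le> (r / \<epsilon>)\<^sup>2"
    using assms by (intro one_le_power) simp
  then show ?thesis
    by (simp add: grad_profile_def bump_profile_deriv_def)
qed

lemma borel_measurable_grad_profile [measurable]: "grad_profile \<epsilon> \<in> borel_measurable borel"
  unfolding grad_profile_def[abs_def] by measurable

lemma measure_surface_measure: "measure surface_measure UNIV = 4 * pi"
  by (simp add: measure_def emeasure_surface_measure emeasure_ball unit_ball_vol_3 enn2real_mult)

lemma radial_integral:
  fixes f :: "real \<Rightarrow> real"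
  assumes [measurable]: "f \<in> borel_measurable borel"
    and int: "integrable lborel (\<lambda>x::real^3. f (norm x))"
  shows "integrable lborel (\<lambda>r. indicator {0<..} r * r\<^sup>2 * f r)"
    and "(\<integral>x. f (norm (x::real^3)) \<partial>lborel) = 4 * pi * (\<integral>r. indicator {0<..} r * r\<^sup>2 * f r \<partial>lborel)"
proof -
  have eq: "(\<lambda>r. indicator {0<..} r * r\<^sup>2 * (\<integral>w. f (norm (r *\<^sub>R w)) \<partial>surface_measure)) =
      (\<lambda>r. (indicator {0<..} r * r\<^sup>2 * f r) * (4 * pi))"
  proof
    fix r :: real
    have "(\<integral>w. f (norm (r *\<^sub>R w)) \<partial>surface_measure) = (\<integral>w. f \<bar>r\<bar> \<partial>surface_measure)"
      by (rule integral_cong_AE) (use AE_surface_measure_sphere in \<open>auto elim!: eventually_mono\<close>)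
    then show "indicator {0<..} r * r\<^sup>2 * (\<integral>w. f (norm (r *\<^sub>R w)) \<partial>surface_measure) =
      (indicator {0<..} r * r\<^sup>2 * f r) * (4 * pi)"
      by (auto simp: measure_surface_measure indicator_def)
  qed
  from integral_polar[OF int, unfolded eq]
  show "integrable lborel (\<lambda>r. indicator {0<..} r * r\<^sup>2 * f r)"
    and "(\<integral>x. f (norm (x::real^3)) \<partial>lborel) = 4 * pi * (\<integral>r. indicator {0<..} r * r\<^sup>2 * f r \<partial>lborel)"
    by simp_all
qed

text \<open>
  The second moment is the mass of the bump in polar coordinates. The fourth moment of the derivative
  follows from it, since \<open>r\<^sup>3 B(r\<^sup>2)\<close> vanishes at \<open>r = 0\<close> and at \<open>r = 1\<close> and its derivative is
  \<open>3 r\<^sup>2 B(r\<^sup>2) + 2 r\<^sup>4 B'(r\<^sup>2)\<close>.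
\<close>

lemma bump_profile_moments:
  "(\<integral>r. indicator {0<..} r * r\<^sup>2 * bump_profile (r\<^sup>2) \<partial>lborel) = bump_mass / (4 * pi)"
  "integrable lborel (\<lambda>r. indicator {0<..} r * (r ^ 4 * bump_profile_deriv (r\<^sup>2)))"
  "(\<integral>r. indicator {0<..} r * (r ^ 4 * bump_profile_deriv (r\<^sup>2)) \<partial>lborel) = - 3 * bump_mass / (8 * pi)"
proof -
  have eq: "(\<lambda>x. bump_profile ((norm x)\<^sup>2)) = bump"
    by (simp add: fun_eq_iff bump_eq_profile power2_norm_eq_inner)
  have [measurable]: "(\<lambda>r::real. bump_profile (r\<^sup>2)) \<in> borel_measurable borel" by measurable
  note R = radial_integral[of "\<lambda>r. bump_profile (r\<^sup>2)", unfolded eq, OF this integrable_bump]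
  show mass: "(\<integral>r. indicator {0<..} r * r\<^sup>2 * bump_profile (r\<^sup>2) \<partial>lborel) = bump_mass / (4 * pi)"
    using R(2) by (simp add: bump_mass_def field_simps)
  show int: "integrable lborel (\<lambda>r. indicator {0<..} r * (r ^ 4 * bump_profile_deriv (r\<^sup>2)))"
  proof (rule Bochner_Integration.integrable_bound[OF _ _ AE_I2])
    show "integrable lborel (\<lambda>r::real. indicator {0..1} r * 2 :: real)"
      by simp
    fix r :: real
    have "\<bar>r ^ 4 * bump_profile_deriv (r\<^sup>2)\<bar> \<le> 1 * 2" if "0 < r" "r < 1"
      unfolding abs_mult
      by (rule mult_mono) (use that bump_profile_bounds(1,2)[of "r\<^sup>2"] in \<open>auto intro!: power_le_one\<close>)
    moreover have "bump_profile_deriv (r\<^sup>2) = 0" if "1 \<le> r"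
      using that by (simp add: bump_profile_deriv_def not_less one_le_power)
    ultimately show "norm (indicator {0<..} r * (r ^ 4 * bump_profile_deriv (r\<^sup>2))) \<le>
        norm (indicator {0..1} r * 2 :: real)"
      by (cases "r < 1") (auto simp: indicator_def)
  qed measurable
  have "((\<lambda>r. 3 * r\<^sup>2 * bump_profile (r\<^sup>2) + 2 * (r ^ 4 * bump_profile_deriv (r\<^sup>2))) has_integral
      1 ^ 3 * bump_profile (1\<^sup>2) - 0 ^ 3 * bump_profile (0\<^sup>2)) {0..1}"
  proof (rule fundamental_theorem_of_calculus)
    fix r :: real
    have "((\<lambda>r. bump_profile (r\<^sup>2)) has_real_derivative bump_profile_deriv (r\<^sup>2) * (2 * r)) (at r)"
      by (rule DERIV_chain2[OF bump_profile_has_derivative]) (auto intro!: derivative_eq_intros)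
    then have "((\<lambda>r. r ^ 3 * bump_profile (r\<^sup>2)) has_real_derivative
        3 * r\<^sup>2 * bump_profile (r\<^sup>2) + 2 * (r ^ 4 * bump_profile_deriv (r\<^sup>2))) (at r)"
      by (auto intro!: derivative_eq_intros simp: power_numeral_reduce)
    then show "((\<lambda>r. r ^ 3 * bump_profile (r\<^sup>2)) has_vector_derivative
        3 * r\<^sup>2 * bump_profile (r\<^sup>2) + 2 * (r ^ 4 * bump_profile_deriv (r\<^sup>2))) (at r within {0..1})"
      by (simp add: has_real_derivative_iff_has_vector_derivative has_vector_derivative_at_within)
  qed simp
  then have ftc: "((\<lambda>r. 3 * r\<^sup>2 * bump_profile (r\<^sup>2) + 2 * (r ^ 4 * bump_profile_deriv (r\<^sup>2)))
      has_integral 0) {0..1}"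
    by (simp add: bump_profile_def)
  let ?F = "\<lambda>r. 3 * (indicator {0<..} r * r\<^sup>2 * bump_profile (r\<^sup>2)) +
      2 * (indicator {0<..} r * (r ^ 4 * bump_profile_deriv (r\<^sup>2)))"
  have "(?F has_integral (\<integral>r. ?F r \<partial>lborel)) UNIV"
    by (rule has_integral_integral_lborel) (use int R(1) in simp)
  moreover have "(?F has_integral 0) UNIV"
  proof (rule has_integral_on_superset[where S="{0..1}"])
    show "(?F has_integral 0) {0..1}"
      by (rule has_integral_eq[OF _ ftc]) (auto simp: indicator_def)
    show "?F r = 0" if "r \<notin> {0..1}" for r
    proof (cases "r > 1")
      case True
      then have "r\<^sup>2 \<ge> 1" by (simp add: one_le_power)
      then show ?thesis by (simp add: bump_profile_def bump_profile_deriv_def)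
    qed (use that in auto)
  qed simp
  ultimately have "(\<integral>r. ?F r \<partial>lborel) = 0"
    by (rule has_integral_unique)
  moreover have "(\<integral>r. ?F r \<partial>lborel) = 3 * (bump_mass / (4 * pi)) +
      2 * (\<integral>r. indicator {0<..} r * (r ^ 4 * bump_profile_deriv (r\<^sup>2)) \<partial>lborel)"
    using int R(1) mass by (subst Bochner_Integration.integral_add) auto
  ultimately show "(\<integral>r. indicator {0<..} r * (r ^ 4 * bump_profile_deriv (r\<^sup>2)) \<partial>lborel) =
      - 3 * bump_mass / (8 * pi)"
    by (simp add: field_simps)
qed

text \<open>
  The weight with which the sphere mean at radius \<open>r\<close> enters the mean against \<open>\<nabla>\<phi>\<^sub>\<epsilon>\<close>: two powers of
  \<open>r\<close> come from the volume element, one from \<open>\<nabla>\<phi>\<^sub>\<epsilon>(l) = Q\<^sub>\<epsilon>(|l|) l\<close>, and one from the division by \<open>r\<close> in the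
  structure function.
\<close>

definition radial_weight :: "real \<Rightarrow> real \<Rightarrow> real" where
  "radial_weight \<epsilon> r = indicator {0<..} r * (- 4 * pi * r ^ 4 * grad_profile \<epsilon> r)"

text \<open>
  Scaling \<open>r = \<epsilon> s\<close> removes \<open>\<epsilon>\<close>, so the total mass is that of \<open>- 8 \<pi> s\<^sup>4 B'(s\<^sup>2)\<close> divided by the mass
  of the bump, which is 3 for every \<open>\<epsilon>\<close>.
\<close>

lemma radial_weight:
  assumes "\<epsilon> > 0"
  shows "integrable lborel (radial_weight \<epsilon>)" "(\<integral>r. radial_weight \<epsilon> r \<partial>lborel) = 3"
    and "radial_weight \<epsilon> r \<ge> 0"
    and "r \<notin> {0<..<\<epsilon>} \<Longrightarrow> radial_weight \<epsilon> r = 0"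
proof -
  let ?f = "\<lambda>r. indicator {0<..} r * (r ^ 4 * bump_profile_deriv (r\<^sup>2))"
  have eq: "radial_weight \<epsilon> (0 + \<epsilon> * s) = - 8 * pi / (bump_mass * \<epsilon>) * ?f s" for s
    using assms bump_mass_pos
    by (simp add: radial_weight_def grad_profile_def indicator_def zero_less_mult_iff
        power_mult_distrib power_numeral_reduce)
  have "integrable lborel (\<lambda>s. radial_weight \<epsilon> (0 + \<epsilon> * s))"
    unfolding eq using bump_profile_moments(2) by simp
  then show "integrable lborel (radial_weight \<epsilon>)"
    using lborel_integrable_real_affine_iff[of \<epsilon> "radial_weight \<epsilon>" 0] assms by simp
  have "(\<integral>r. radial_weight \<epsilon> r \<partial>lborel) = \<epsilon> * (\<integral>s. radial_weight \<epsilon> (0 + \<epsilon> * s) \<partial>lborel)"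
    using lborel_integral_real_affine[of \<epsilon> "radial_weight \<epsilon>" 0] assms by simp
  also have "\<dots> = 3"
    unfolding eq integral_mult_right_zero bump_profile_moments(3)
    using assms bump_mass_pos by simp
  finally show "(\<integral>r. radial_weight \<epsilon> r \<partial>lborel) = 3" .
  show "radial_weight \<epsilon> r \<ge> 0"
    using grad_profile_nonpos[OF assms, of r]
    by (auto simp: radial_weight_def indicator_def mult_nonneg_nonpos)
  show "r \<notin> {0<..<\<epsilon>} \<Longrightarrow> radial_weight \<epsilon> r = 0"
    using grad_profile_outside[OF assms, of r] by (auto simp: radial_weight_def indicator_def)
qed

section \<open>Sphere means and mollified means of a flux\<close>

lemma borel_torus_cell [measurable]: "torus_cell \<in> sets borel"
  by (simp add: torus_cell_def)

abbreviation cylinder :: "real \<Rightarrow> spacetime set" where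
  "cylinder T \<equiv> torus_cell \<times> {0<..<T}"

lemma borel_cylinder [measurable]: "cylinder T \<in> sets borel"
  by (intro borel_Times borel_torus_cell) simp

text \<open>
  The properties of a test function that make its product with an integrable function integrable.
\<close>

definition bounded_weight :: "real \<Rightarrow> (spacetime \<Rightarrow> real) \<Rightarrow> bool" where
  "bounded_weight T \<psi> \<longleftrightarrow> \<psi> \<in> borel_measurable borel \<and> (\<exists>K. \<forall>z\<in>cylinder T. \<bar>\<psi> z\<bar> \<le> K)"

lemma test_function_bounded_weight:
  assumes "\<psi> \<in> test_functions T"
  shows "bounded_weight T \<psi>"
proof -
  obtain a c where "\<psi> \<in> smooth_supported a c"
    using assms by (auto simp: test_functions_def)
  then have sm: "smooth \<psi>" and supp: "\<And>x t. t \<notin> {a..c} \<Longrightarrow> \<psi> (x, t) = 0"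
    by (auto simp: smooth_supported_def)
  have "iterated_partial [] \<psi> differentiable_on UNIV"
    using sm unfolding smooth_def by (metis empty_subsetI list.set(1))
  then have cont: "continuous_on UNIV \<psi>"
    by (simp add: differentiable_imp_continuous_on)
  have "compact (torus_cell \<times> {a..c})"
    by (simp add: torus_cell_def compact_Times)
  then have "bounded (\<psi> ` (torus_cell \<times> {a..c}))"
    by (intro compact_imp_bounded compact_continuous_image continuous_on_subset[OF cont]) auto
  then obtain K where K: "\<And>z. z \<in> torus_cell \<times> {a..c} \<Longrightarrow> \<bar>\<psi> z\<bar> \<le> K"
    by (auto simp: bounded_iff)
  have "\<bar>\<psi> (x, t)\<bar> \<le> max K 0" if "x \<in> torus_cell" for x t
    using K[of "(x, t)"] supp[of t x] that by (cases "t \<in> {a..c}") auto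
  with cont show ?thesis
    unfolding bounded_weight_def by (auto intro!: borel_measurable_continuous_onI exI[of _ "max K 0"])
qed

text \<open>
  The indicator confines measurability to the times in \<open>(0, T)\<close>, outside which fields may be arbitrary.
  The radius 1 leaves room for the displacements \<open>r \<omega>\<close> with \<open>r \<le> 1\<close> and for the support of the mollifier.
\<close>

definition integrable_flux :: "real \<Rightarrow> (real^3 \<Rightarrow> spacetime \<Rightarrow> real^3) \<Rightarrow> bool" where
  "integrable_flux T V \<longleftrightarrow>
     (\<lambda>(l, z). indicator (cylinder T) z *\<^sub>R V l z) \<in> borel_measurable borel \<and>
     (\<exists>C::real. \<forall>l. norm l \<le> 1 \<longrightarrow>
        (\<integral>\<^sup>+z. ennreal (norm (indicator (cylinder T) z *\<^sub>R V l z)) \<partial>lborel) \<le> ennreal C)"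

lemma integrable_flux_measurable:
  assumes "integrable_flux T V" "z \<in> cylinder T"
  shows "(\<lambda>l. V l z) \<in> borel_measurable borel"
proof -
  have "(\<lambda>(l, z). indicator (cylinder T) z *\<^sub>R V l z) \<in> borel_measurable (borel \<Otimes>\<^sub>M borel)"
    using assms by (simp add: integrable_flux_def borel_prod)
  from measurable_Pair1[OF this, of z] assms(2) show ?thesis by simp
qed

text \<open>
  One exchange of integrals covers both averages: \<open>M\<close> is the surface measure with \<open>c w = w\<close> and
  \<open>m w = r w\<close> for the structure functions, and Lebesgue measure with \<open>c = \<nabla>\<phi>\<^sub>\<epsilon>\<close> and \<open>m l = l\<close> for the
  mollified flux.
\<close>

lemma integrable_flux_Fubini:
  fixes c m :: "'m \<Rightarrow> real^3"
  assumes V: "integrable_flux T V" and \<psi>: "bounded_weight T \<psi>"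
    and M: "sigma_finite_measure M" and c: "integrable M c"
    and m[measurable]: "m \<in> borel_measurable M"
    and small: "AE x in M. c x \<noteq> 0 \<longrightarrow> norm (m x) \<le> 1"
  shows "set_integrable lborel (cylinder T) (\<lambda>z. (\<integral>x. c x \<bullet> V (m x) z \<partial>M) * \<psi> z)"
    and "integrable M (\<lambda>x. pairing T (\<lambda>z. c x \<bullet> V (m x) z) \<psi>)"
    and "pairing T (\<lambda>z. \<integral>x. c x \<bullet> V (m x) z \<partial>M) \<psi> =
      (\<integral>x. pairing T (\<lambda>z. c x \<bullet> V (m x) z) \<psi> \<partial>M)"
proof -
  interpret M: sigma_finite_measure M by (rule M)
  interpret P: pair_sigma_finite M "lborel :: spacetime measure" ..
  have [measurable]: "c \<in> borel_measurable M" using c by simp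
  have [measurable]: "\<psi> \<in> borel_measurable borel" using \<psi> by (simp add: bounded_weight_def)
  obtain K where K: "\<And>z. z \<in> cylinder T \<Longrightarrow> \<bar>\<psi> z\<bar> \<le> K"
    using \<psi> by (auto simp: bounded_weight_def)
  obtain C where C: "\<And>l. norm l \<le> 1 \<Longrightarrow>
      (\<integral>\<^sup>+z. ennreal (norm (indicator (cylinder T) z *\<^sub>R V l z)) \<partial>lborel) \<le> ennreal C"
    using V by (auto simp: integrable_flux_def)
  define W where "W = (\<lambda>p. indicator (cylinder T) (snd p) *\<^sub>R V (fst p) (snd p))"
  have W[measurable]: "W \<in> borel_measurable (borel \<Otimes>\<^sub>M borel)"
    using V by (simp add: integrable_flux_def W_def case_prod_beta' borel_prod)
  define H where "H = (\<lambda>(x, z). c x \<bullet> W (m x, z) * \<psi> z)"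
  have Hm: "H \<in> borel_measurable (M \<Otimes>\<^sub>M lborel)"
    unfolding H_def by measurable
  have H_bound: "\<bar>H (x, z)\<bar> \<le> (\<bar>K\<bar> * norm (c x)) * norm (W (m x, z))" for x z
  proof (cases "z \<in> cylinder T")
    case True
    have "\<bar>c x \<bullet> W (m x, z)\<bar> * \<bar>\<psi> z\<bar> \<le> (norm (c x) * norm (W (m x, z))) * \<bar>K\<bar>"
      by (intro mult_mono Cauchy_Schwarz_ineq2) (use K[OF True] in auto)
    then show ?thesis by (simp add: H_def abs_mult mult_ac)
  qed (simp add: H_def W_def)
  have "(\<integral>\<^sup>+p. ennreal (norm (H p)) \<partial>(M \<Otimes>\<^sub>M lborel)) =
      (\<integral>\<^sup>+x. \<integral>\<^sup>+z. ennreal (norm (H (x, z))) \<partial>lborel \<partial>M)"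
    by (rule lborel.nn_integral_fst[symmetric]) (use Hm in measurable)
  also have "\<dots> \<le> (\<integral>\<^sup>+x. ennreal (\<bar>K\<bar> * norm (c x)) * ennreal \<bar>C\<bar> \<partial>M)"
  proof (rule nn_integral_mono_AE, use small in eventually_elim)
    fix x assume x: "c x \<noteq> 0 \<longrightarrow> norm (m x) \<le> 1"
    have "(\<integral>\<^sup>+z. ennreal (norm (H (x, z))) \<partial>lborel) \<le>
        (\<integral>\<^sup>+z. ennreal (\<bar>K\<bar> * norm (c x)) * ennreal (norm (W (m x, z))) \<partial>lborel)"
      using H_bound[of x] by (intro nn_integral_mono) (simp add: ennreal_mult[symmetric] ennreal_leI)
    also have "\<dots> = ennreal (\<bar>K\<bar> * norm (c x)) * (\<integral>\<^sup>+z. ennreal (norm (W (m x, z))) \<partial>lborel)"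
      by (rule nn_integral_cmult) measurable
    also have "\<dots> \<le> ennreal (\<bar>K\<bar> * norm (c x)) * ennreal \<bar>C\<bar>"
    proof (cases "c x = 0")
      case False
      then have "(\<integral>\<^sup>+z. ennreal (norm (W (m x, z))) \<partial>lborel) \<le> ennreal C"
        using C[of "m x"] x by (simp add: W_def)
      also have "\<dots> \<le> ennreal \<bar>C\<bar>" by (simp add: ennreal_leI)
      finally show ?thesis by (rule mult_left_mono) simp
    qed simp
    finally show "(\<integral>\<^sup>+z. ennreal (norm (H (x, z))) \<partial>lborel) \<le> ennreal (\<bar>K\<bar> * norm (c x)) * ennreal \<bar>C\<bar>" .
  qed
  also have "\<dots> = (\<integral>\<^sup>+x. ennreal (norm ((\<bar>C\<bar> * \<bar>K\<bar>) *\<^sub>R c x)) \<partial>M)"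
    by (simp add: ennreal_mult[symmetric] mult_ac)
  also have "\<dots> < \<infinity>"
    using integrable_scaleR_right[OF c, of "\<bar>C\<bar> * \<bar>K\<bar>"] by (simp add: integrable_iff_bounded)
  finally have H: "integrable (M \<Otimes>\<^sub>M lborel) H"
    using Hm by (simp add: integrable_iff_bounded)
  have H_slice: "(\<integral>z. H (x, z) \<partial>lborel) = pairing T (\<lambda>z. c x \<bullet> V (m x) z) \<psi>" for x
    unfolding pairing_def set_lebesgue_integral_def
    by (rule Bochner_Integration.integral_cong) (auto simp: H_def W_def indicator_def)
  have H_slice': "(\<integral>x. H (x, z) \<partial>M) =
      indicator (cylinder T) z *\<^sub>R ((\<integral>x. c x \<bullet> V (m x) z \<partial>M) * \<psi> z)" for z
    by (auto simp: H_def W_def indicator_def)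
  show "integrable M (\<lambda>x. pairing T (\<lambda>z. c x \<bullet> V (m x) z) \<psi>)"
    using P.integrable_fst'[OF H] by (simp add: H_slice)
  have H': "integrable (M \<Otimes>\<^sub>M lborel) (\<lambda>(x, z). H (x, z))"
    using H by simp
  show "set_integrable lborel (cylinder T) (\<lambda>z. (\<integral>x. c x \<bullet> V (m x) z \<partial>M) * \<psi> z)"
    using P.integrable_snd[OF H'] by (simp add: set_integrable_def H_slice')
  have "pairing T (\<lambda>z. \<integral>x. c x \<bullet> V (m x) z \<partial>M) \<psi> = (\<integral>z. (\<integral>x. H (x, z) \<partial>M) \<partial>lborel)"
    by (simp add: pairing_def set_lebesgue_integral_def H_slice')
  also have "\<dots> = (\<integral>x. (\<integral>z. H (x, z) \<partial>lborel) \<partial>M)"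
    by (rule P.Fubini_integral[OF H'])
  finally show "pairing T (\<lambda>z. \<integral>x. c x \<bullet> V (m x) z \<partial>M) \<psi> =
      (\<integral>x. pairing T (\<lambda>z. c x \<bullet> V (m x) z) \<psi> \<partial>M)"
    by (simp add: H_slice)
qed

text \<open>
  The one-point measure turns the Fubini lemma into a statement about a single displacement.
\<close>

lemma integrable_flux_slice:
  assumes V: "integrable_flux T V" and \<psi>: "bounded_weight T \<psi>" and l: "norm l \<le> 1"
  shows "set_integrable lborel (cylinder T) (\<lambda>z. (c \<bullet> V l z) * \<psi> z)"
proof -
  have "finite_measure (count_space (UNIV :: unit set))"
    by (simp add: finite_measure_count_space)
  then show ?thesis
    using integrable_flux_Fubini(1)[OF V \<psi>, of "count_space (UNIV :: unit set)" "\<lambda>_. c" "\<lambda>_. l"] l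
    by (simp add: finite_measure_def lebesgue_integral_count_space_finite integrable_count_space)
qed

definition flux_pairing ::
    "real \<Rightarrow> (real^3 \<Rightarrow> spacetime \<Rightarrow> real^3) \<Rightarrow> (spacetime \<Rightarrow> real) \<Rightarrow> real^3 \<Rightarrow> real" where
  "flux_pairing T V \<psi> l = pairing T (\<lambda>z. l \<bullet> V l z) \<psi>"

text \<open>
  The pairing of the structure function at scale \<open>r\<close>. One factor \<open>1 / r\<close> is the one in its definition,
  the other compensates for \<open>r w\<close> in place of the unit normal \<open>w\<close> in \<open>flux_pairing\<close>.
\<close>

definition sphere_mean ::
    "real \<Rightarrow> (real^3 \<Rightarrow> spacetime \<Rightarrow> real^3) \<Rightarrow> (spacetime \<Rightarrow> real) \<Rightarrow> real \<Rightarrow> real" where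
  "sphere_mean T V \<psi> r =
     - (\<integral>w. flux_pairing T V \<psi> (r *\<^sub>R w) \<partial>surface_measure) / (4 * pi * r\<^sup>2)"

lemma flux_pairing_measurable:
  assumes V: "integrable_flux T V" and \<psi>: "bounded_weight T \<psi>"
  shows "flux_pairing T V \<psi> \<in> borel_measurable borel"
proof -
  have [measurable]: "\<psi> \<in> borel_measurable borel" using \<psi> by (simp add: bounded_weight_def)
  define W where "W = (\<lambda>p. indicator (cylinder T) (snd p) *\<^sub>R V (fst p) (snd p))"
  have [measurable]: "W \<in> borel_measurable (borel \<Otimes>\<^sub>M borel)"
    using V by (simp add: integrable_flux_def W_def case_prod_beta' borel_prod)
  have "flux_pairing T V \<psi> l = (\<integral>z. l \<bullet> W (l, z) * \<psi> z \<partial>lborel)" for l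
    unfolding flux_pairing_def pairing_def set_lebesgue_integral_def
    by (rule Bochner_Integration.integral_cong) (auto simp: W_def indicator_def)
  then show ?thesis
    by (subst measurable_cong) (assumption, measurable)
qed

lemma pairing_cong:
  assumes "\<And>z. z \<in> cylinder T \<Longrightarrow> f z = g z"
  shows "pairing T f \<psi> = pairing T g \<psi>"
  unfolding pairing_def set_lebesgue_integral_def
  by (rule Bochner_Integration.integral_cong) (auto simp: assms indicator_def)

lemma pairing_cmult: "pairing T (\<lambda>z. a * f z) \<psi> = a * pairing T f \<psi>"
  by (simp add: pairing_def mult.assoc)

lemma surface_identity_integrable: "integrable surface_measure (\<lambda>w. w)"
  by (rule surface.integrable_const_bound[where B=1])
    (use AE_surface_measure_sphere in \<open>auto elim!: eventually_mono\<close>)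

lemma sphere_average_pairing:
  assumes V: "integrable_flux T V" and \<psi>: "bounded_weight T \<psi>" and r: "0 < r" "r \<le> 1"
  shows "integrable surface_measure (\<lambda>w. flux_pairing T V \<psi> (r *\<^sub>R w))"
    and "pairing T (\<lambda>z. - (1 / r) * (\<integral>w\<in>sphere 0 1. (w \<bullet> V (r *\<^sub>R w) z) / (4 * pi) \<partial>surface_measure)) \<psi>
      = sphere_mean T V \<psi> r"
proof -
  have "AE w in surface_measure. w \<noteq> 0 \<longrightarrow> norm (r *\<^sub>R w) \<le> 1"
    using AE_surface_measure_sphere by eventually_elim (use r in simp)
  note F = integrable_flux_Fubini[OF V \<psi> surface.sigma_finite_measure_axioms
      surface_identity_integrable _ this, simplified]
  have A: "flux_pairing T V \<psi> (r *\<^sub>R w) = r * pairing T (\<lambda>z. w \<bullet> V (r *\<^sub>R w) z) \<psi>" for w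
    by (simp add: flux_pairing_def pairing_cmult)
  show "integrable surface_measure (\<lambda>w. flux_pairing T V \<psi> (r *\<^sub>R w))"
    unfolding A using F(2) by simp
  have S: "- (1 / r) * (\<integral>w\<in>sphere 0 1. (w \<bullet> V (r *\<^sub>R w) z) / (4 * pi) \<partial>surface_measure) =
      - (1 / (4 * pi * r)) * (\<integral>w. w \<bullet> V (r *\<^sub>R w) z \<partial>surface_measure)" if "z \<in> cylinder T" for z
  proof -
    have [measurable]: "(\<lambda>l. V l z) \<in> borel_measurable borel"
      by (rule integrable_flux_measurable[OF V that])
    have "(\<integral>w\<in>sphere 0 1. (w \<bullet> V (r *\<^sub>R w) z) / (4 * pi) \<partial>surface_measure) =
        (\<integral>w. (w \<bullet> V (r *\<^sub>R w) z) / (4 * pi) \<partial>surface_measure)"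
      unfolding set_lebesgue_integral_def
    proof (rule integral_cong_AE)
      have [measurable]: "sphere (0::real^3) 1 \<in> sets borel" by simp
      show "(\<lambda>w. indicat_real (sphere 0 1) w *\<^sub>R ((w \<bullet> V (r *\<^sub>R w) z) / (4 * pi)))
          \<in> borel_measurable surface_measure"
        by measurable
    qed (use AE_surface_measure_sphere in \<open>auto elim!: eventually_mono\<close>)
    then show ?thesis by simp
  qed
  have "pairing T (\<lambda>z. - (1 / r) * (\<integral>w\<in>sphere 0 1. (w \<bullet> V (r *\<^sub>R w) z) / (4 * pi) \<partial>surface_measure)) \<psi>
      = pairing T (\<lambda>z. - (1 / (4 * pi * r)) * (\<integral>w. w \<bullet> V (r *\<^sub>R w) z \<partial>surface_measure)) \<psi>"
    by (rule pairing_cong) (rule S)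
  then show "pairing T (\<lambda>z. - (1 / r) * (\<integral>w\<in>sphere 0 1. (w \<bullet> V (r *\<^sub>R w) z) / (4 * pi) \<partial>surface_measure)) \<psi>
      = sphere_mean T V \<psi> r"
    unfolding pairing_cmult F(3) sphere_mean_def A
    using r by (simp add: power2_eq_square)
qed

definition mollified_flux :: "(real^3 \<Rightarrow> spacetime \<Rightarrow> real^3) \<Rightarrow> real \<Rightarrow> spacetime \<Rightarrow> real" where
  "mollified_flux V \<epsilon> z = (LINT l:torus_cell|lborel. grad (mollifier \<epsilon>) l \<bullet> V l z)"

lemma ball_subset_torus_cell: "norm l \<le> 1 / 2 \<Longrightarrow> l \<in> torus_cell"
proof -
  assume "norm l \<le> 1 / 2"
  then have "- 1 / 2 \<le> l $ i \<and> l $ i \<le> 1 / 2" for i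
    using component_le_norm_cart[of l i] by linarith
  then show "l \<in> torus_cell"
    by (simp add: torus_cell_def mem_box_cart)
qed

text \<open>
  After the space-time integral has been carried out first, the integrand in \<open>l\<close> is \<open>Q\<^sub>\<epsilon>(|l|)\<close> times the
  pairing \<open>flux_pairing T V \<psi> l\<close>. Only the latter depends on direction, so polar coordinates
  produce the sphere means.
\<close>

lemma mollified_flux_pairing:
  assumes V: "integrable_flux T V" and \<psi>: "bounded_weight T \<psi>" and \<epsilon>: "0 < \<epsilon>" "\<epsilon> \<le> 1 / 2"
  shows "set_integrable lborel (cylinder T) (\<lambda>z. mollified_flux V \<epsilon> z * \<psi> z)"
    and "integrable lborel (\<lambda>r. radial_weight \<epsilon> r * sphere_mean T V \<psi> r)"
    and "pairing T (mollified_flux V \<epsilon>) \<psi> =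
      (\<integral>r. radial_weight \<epsilon> r * sphere_mean T V \<psi> r \<partial>lborel)"
proof -
  define c where "c l = grad_profile \<epsilon> (norm l) *\<^sub>R l" for l :: "real^3"
  have c_outside: "c l = 0" if "norm l \<ge> \<epsilon>" for l
    using grad_profile_outside[OF \<epsilon>(1) that] by (simp add: c_def)
  have [measurable]: "c \<in> borel_measurable borel"
    unfolding c_def by measurable
  have c: "integrable lborel c"
  proof (rule Bochner_Integration.integrable_bound[OF _ _ AE_I2])
    show "integrable lborel (\<lambda>l. indicator (ball (0::real^3) 1) l * (4 / (bump_mass * \<epsilon> ^ 5)))"
      using emeasure_bounded_finite[OF bounded_ball, of "0::real^3" 1] by (simp add: integrable_indicator_iff)
    fix l :: "real^3"
    show "norm (c l) \<le> norm (indicator (ball 0 1) l * (4 / (bump_mass * \<epsilon> ^ 5)))"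
    proof (cases "norm l < 1")
      case True
      have "\<bar>grad_profile \<epsilon> (norm l)\<bar> * norm l \<le> (4 / (bump_mass * \<epsilon> ^ 5)) * 1"
        using True grad_profile_bounded[OF \<epsilon>(1), of "norm l"] \<epsilon>(1) less_imp_le[OF bump_mass_pos]
        by (intro mult_mono) auto
      then show ?thesis
        using True \<epsilon> less_imp_le[OF bump_mass_pos] by (simp add: c_def abs_mult)
    qed (use c_outside[of l] \<epsilon> in simp)
  qed measurable
  have "AE l in lborel. c l \<noteq> 0 \<longrightarrow> norm l \<le> 1"
    proof (intro AE_I2 impI)
    fix l assume "c l \<noteq> 0"
    then have "norm l < \<epsilon>" using c_outside[of l] by (meson not_less)
    then show "norm l \<le> 1" using \<epsilon>(2) by simp
  qed
  note F = integrable_flux_Fubini[OF V \<psi> lborel.sigma_finite_measure_axioms c _ this, simplified]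
  have J: "mollified_flux V \<epsilon> z = (\<integral>l. c l \<bullet> V l z \<partial>lborel)" for z
    unfolding mollified_flux_def set_lebesgue_integral_def
  proof (rule Bochner_Integration.integral_cong)
    fix l :: "real^3"
    show "indicat_real torus_cell l *\<^sub>R (grad (mollifier \<epsilon>) l \<bullet> V l z) = c l \<bullet> V l z"
      using c_outside[of l] ball_subset_torus_cell[of l] \<epsilon>
      by (cases "norm l \<ge> \<epsilon>") (auto simp: grad_mollifier c_def indicator_def)
  qed simp
  show "set_integrable lborel (cylinder T) (\<lambda>z. mollified_flux V \<epsilon> z * \<psi> z)"
    unfolding J by (rule F(1))
  have A: "pairing T (\<lambda>z. c l \<bullet> V l z) \<psi> = grad_profile \<epsilon> (norm l) * flux_pairing T V \<psi> l" for l
    by (simp add: c_def flux_pairing_def pairing_cmult)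
  have R: "indicator {0<..} r * r\<^sup>2 *
      (\<integral>w. grad_profile \<epsilon> (norm (r *\<^sub>R w)) * flux_pairing T V \<psi> (r *\<^sub>R w) \<partial>surface_measure) =
      radial_weight \<epsilon> r * sphere_mean T V \<psi> r" for r
  proof (cases "r > 0")
    case True
    have [measurable]: "flux_pairing T V \<psi> \<in> borel_measurable borel"
      by (rule flux_pairing_measurable[OF V \<psi>])
    have "(\<integral>w. grad_profile \<epsilon> (norm (r *\<^sub>R w)) * flux_pairing T V \<psi> (r *\<^sub>R w) \<partial>surface_measure) =
        (\<integral>w. grad_profile \<epsilon> r * flux_pairing T V \<psi> (r *\<^sub>R w) \<partial>surface_measure)"
      by (rule integral_cong_AE) (measurable, use AE_surface_measure_sphere True in \<open>auto elim!: eventually_mono\<close>)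
    then show ?thesis
      using True by (simp add: radial_weight_def sphere_mean_def power_numeral_reduce)
  qed (simp add: radial_weight_def)
  note P = integral_polar[OF F(2)[unfolded A], unfolded R]
  show "integrable lborel (\<lambda>r. radial_weight \<epsilon> r * sphere_mean T V \<psi> r)"
    by (rule P(1))
  show "pairing T (mollified_flux V \<epsilon>) \<psi> =
      (\<integral>r. radial_weight \<epsilon> r * sphere_mean T V \<psi> r \<partial>lborel)"
    using F(3) P(2) by (simp add: J[abs_def] A)
qed

text \<open>
  The weights have mass 3 and concentrate at radius 0, so they average a function converging to \<open>L\<close> to
  \<open>3 L\<close>. Being nonnegative, they have absolute mass 3 as well, which bounds the error.
\<close>

lemma mollified_flux_limit:
  assumes V: "integrable_flux T V" and \<psi>: "bounded_weight T \<psi>"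
    and lim: "(sphere_mean T V \<psi> \<longlongrightarrow> L) (at_right 0)"
  shows "((\<lambda>\<epsilon>. pairing T (mollified_flux V \<epsilon>) \<psi>) \<longlongrightarrow> 3 * L) (at_right 0)"
proof (rule tendstoI)
  fix e :: real assume "e > 0"
  then have "\<forall>\<^sub>F r in at_right 0. dist (sphere_mean T V \<psi> r) L < e / 4"
    using lim by (intro tendstoD) auto
  then obtain d where d: "d > 0" "\<And>r. 0 < r \<Longrightarrow> r < d \<Longrightarrow> \<bar>sphere_mean T V \<psi> r - L\<bar> < e / 4"
    unfolding eventually_at_right_field by (auto simp: dist_real_def)
  have "dist (pairing T (mollified_flux V \<epsilon>) \<psi>) (3 * L) < e" if "0 < \<epsilon>" "\<epsilon> < min d (1 / 2)" for \<epsilon>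
  proof -
    have \<epsilon>: "0 < \<epsilon>" "\<epsilon> \<le> 1 / 2" "\<epsilon> < d" using that by auto
    note w = radial_weight[OF \<epsilon>(1)] and J = mollified_flux_pairing[OF V \<psi> \<epsilon>(1,2)]
    have "(\<integral>r. radial_weight \<epsilon> r * sphere_mean T V \<psi> r \<partial>lborel) - L * 3 =
        (\<integral>r. radial_weight \<epsilon> r * sphere_mean T V \<psi> r - L * radial_weight \<epsilon> r \<partial>lborel)"
      using J(2) w(1) by (subst Bochner_Integration.integral_diff) (auto simp: w(2))
    also have "\<bar>\<dots>\<bar> \<le> (\<integral>r. (e / 4) * radial_weight \<epsilon> r \<partial>lborel)"
    proof (rule integral_abs_bound_integral)
      show "\<bar>radial_weight \<epsilon> r * sphere_mean T V \<psi> r - L * radial_weight \<epsilon> r\<bar> \<le>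
          e / 4 * radial_weight \<epsilon> r" for r
      proof (cases "r \<in> {0<..<\<epsilon>}")
        case True
        then have "\<bar>sphere_mean T V \<psi> r - L\<bar> * radial_weight \<epsilon> r \<le> e / 4 * radial_weight \<epsilon> r"
          using d(2)[of r] \<epsilon> w(3)[of r] by (intro mult_right_mono) auto
        also have "\<bar>sphere_mean T V \<psi> r - L\<bar> * radial_weight \<epsilon> r =
            \<bar>radial_weight \<epsilon> r * sphere_mean T V \<psi> r - L * radial_weight \<epsilon> r\<bar>"
          using w(3)[of r] by (metis abs_mult abs_of_nonneg left_diff_distrib mult.commute)
        finally show ?thesis .
      qed (use w(4)[of r] in auto)
    qed (use J(2) w(1) in auto)
    also have "\<dots> = 3 * e / 4" by (simp add: w(2))
    finally show ?thesis
      using \<open>e > 0\<close> by (simp add: J(3) dist_real_def mult.commute)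
  qed
  moreover have "0 < min d (1 / 2)" using d(1) by simp
  ultimately show "\<forall>\<^sub>F \<epsilon> in at_right 0. dist (pairing T (mollified_flux V \<epsilon>) \<psi>) (3 * L) < e"
    unfolding eventually_at_right_field by blast
qed

lemma integrable_flux_add:
  assumes "integrable_flux T V" "integrable_flux T V'"
  shows "integrable_flux T (\<lambda>l z. V l z + V' l z)"
proof -
  let ?W = "\<lambda>V (l, z). indicator (cylinder T) z *\<^sub>R V l z"
  have m: "?W V \<in> borel_measurable borel" "?W V' \<in> borel_measurable borel"
    using assms by (auto simp: integrable_flux_def)
  have slice: "(\<lambda>z. ennreal (norm (indicator (cylinder T) z *\<^sub>R U l z))) \<in> borel_measurable lborel"
    if "integrable_flux T U" for U and l :: "real^3"
  proof -
    have "(\<lambda>z. indicator (cylinder T) z *\<^sub>R U l z) \<in> borel_measurable borel"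
      using that measurable_Pair2[of "?W U" borel borel borel l]
      by (simp add: integrable_flux_def borel_prod)
    from measurable_compose[OF measurable_compose[OF this borel_measurable_norm] measurable_ennreal]
    show ?thesis by simp
  qed
  obtain C C' where C: "\<And>l. norm l \<le> 1 \<Longrightarrow>
      (\<integral>\<^sup>+z. ennreal (norm (indicator (cylinder T) z *\<^sub>R V l z)) \<partial>lborel) \<le> ennreal C"
      "\<And>l. norm l \<le> 1 \<Longrightarrow>
      (\<integral>\<^sup>+z. ennreal (norm (indicator (cylinder T) z *\<^sub>R V' l z)) \<partial>lborel) \<le> ennreal C'"
    using assms by (auto simp: integrable_flux_def)
  have "(\<integral>\<^sup>+z. ennreal (norm (indicator (cylinder T) z *\<^sub>R (V l z + V' l z))) \<partial>lborel) \<le>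
      ennreal (\<bar>C\<bar> + \<bar>C'\<bar>)" if "norm l \<le> 1" for l
  proof -
    have "(\<integral>\<^sup>+z. ennreal (norm (indicator (cylinder T) z *\<^sub>R (V l z + V' l z))) \<partial>lborel) \<le>
        (\<integral>\<^sup>+z. ennreal (norm (indicator (cylinder T) z *\<^sub>R V l z)) +
          ennreal (norm (indicator (cylinder T) z *\<^sub>R V' l z)) \<partial>lborel)"
      by (intro nn_integral_mono)
        (simp add: ennreal_plus[symmetric] scaleR_add_right ennreal_leI norm_triangle_ineq del: ennreal_plus norm_scaleR)
    also have "\<dots> = (\<integral>\<^sup>+z. ennreal (norm (indicator (cylinder T) z *\<^sub>R V l z)) \<partial>lborel) +
        (\<integral>\<^sup>+z. ennreal (norm (indicator (cylinder T) z *\<^sub>R V' l z)) \<partial>lborel)"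
      by (rule nn_integral_add[OF slice[OF assms(1)] slice[OF assms(2)]])
    also have "\<dots> \<le> ennreal \<bar>C\<bar> + ennreal \<bar>C'\<bar>"
      using C[OF that] by (intro add_mono) (erule order_trans, simp add: ennreal_leI)+
    finally show ?thesis by simp
  qed
  moreover have "?W (\<lambda>l z. V l z + V' l z) \<in> borel_measurable borel"
    using borel_measurable_add[OF m] by (simp add: case_prod_beta' scaleR_add_right)
  ultimately show ?thesis
    unfolding integrable_flux_def by blast
qed

lemma sphere_mean_add:
  assumes V: "integrable_flux T V" "integrable_flux T V'" and \<psi>: "bounded_weight T \<psi>" and r: "0 < r" "r \<le> 1"
  shows "sphere_mean T (\<lambda>l z. V l z + V' l z) \<psi> r = sphere_mean T V \<psi> r + sphere_mean T V' \<psi> r"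
proof -
  have A: "flux_pairing T (\<lambda>l z. V l z + V' l z) \<psi> l = flux_pairing T V \<psi> l + flux_pairing T V' \<psi> l"
    if "norm l \<le> 1" for l
    using integrable_flux_slice[OF V(1) \<psi> that, of l] integrable_flux_slice[OF V(2) \<psi> that, of l]
    by (simp add: flux_pairing_def pairing_def inner_add_right distrib_right set_integral_add)
  have m: "flux_pairing T U \<psi> \<in> borel_measurable borel" if "integrable_flux T U" for U
    by (rule flux_pairing_measurable[OF that \<psi>])
  note [measurable] = m[OF V(1)] m[OF V(2)] m[OF integrable_flux_add[OF V]]
  have "(\<integral>w. flux_pairing T (\<lambda>l z. V l z + V' l z) \<psi> (r *\<^sub>R w) \<partial>surface_measure) =
      (\<integral>w. flux_pairing T V \<psi> (r *\<^sub>R w) + flux_pairing T V' \<psi> (r *\<^sub>R w) \<partial>surface_measure)"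
    by (rule integral_cong_AE)
      (measurable, use AE_surface_measure_sphere r in \<open>auto elim!: eventually_mono intro!: A\<close>)
  also have "\<dots> = (\<integral>w. flux_pairing T V \<psi> (r *\<^sub>R w) \<partial>surface_measure) +
      (\<integral>w. flux_pairing T V' \<psi> (r *\<^sub>R w) \<partial>surface_measure)"
    by (intro Bochner_Integration.integral_add sphere_average_pairing(1) V \<psi> r)
  finally show ?thesis
    by (simp add: sphere_mean_def add_divide_distrib diff_divide_distrib)
qed

section \<open>Cubic integrability of increments\<close>

text \<open>
  Setting the field to 0 off the time interval gives a Borel function on all of space-time, which can be
  translated and integrated over the product.
\<close>

definition cube_norm :: "real \<Rightarrow> (spacetime \<Rightarrow> real^3) \<Rightarrow> spacetime \<Rightarrow> ennreal" where
  "cube_norm T f z = ennreal (norm (indicator (UNIV \<times> {0<..<T}) z *\<^sub>R f z) ^ 3)"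

lemma torus_field_measurable:
  assumes "torus_field T f"
  shows "(\<lambda>z. indicator (UNIV \<times> {0<..<T}) z *\<^sub>R f z) \<in> borel_measurable borel"
proof -
  have "(UNIV :: (real^3) set) \<times> {0<..<T} \<inter> space borel \<in> sets borel"
    by (simp add: open_Times)
  then show ?thesis
    using assms borel_measurable_restrict_space_iff[of "UNIV \<times> {0<..<T}" borel f]
    by (simp add: torus_field_def)
qed

lemma cube_norm_measurable:
  assumes "torus_field T f"
  shows "cube_norm T f \<in> borel_measurable borel"
proof -
  define g where "g z = indicator (UNIV \<times> {0<..<T}) z *\<^sub>R f z" for z
  have [measurable]: "g \<in> borel_measurable borel"
    using torus_field_measurable[OF assms] by (simp add: g_def[abs_def])
  have "(\<lambda>z. ennreal (norm (g z) ^ 3)) \<in> borel_measurable borel"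
    by measurable
  then show ?thesis
    by (simp only: g_def cube_norm_def[abs_def])
qed

lemma L3_L3_iff:
  "f \<in> L3_L3 T \<longleftrightarrow> torus_field T f \<and>
     (\<integral>\<^sup>+z. indicator (cylinder T) z * cube_norm T f z \<partial>lborel) < \<infinity>"
proof -
  have "(\<integral>\<^sup>+t\<in>{0<..<T}. (\<integral>\<^sup>+x\<in>torus_cell. ennreal (norm (f (x, t)) ^ 3) \<partial>lborel) \<partial>lborel) =
      (\<integral>\<^sup>+z. indicator (cylinder T) z * cube_norm T f z \<partial>lborel)" if "torus_field T f"
  proof -
    note [measurable] = cube_norm_measurable[OF that]
    have [measurable]: "(\<lambda>z. indicator (cylinder T) z * cube_norm T f z)
        \<in> borel_measurable (lborel \<Otimes>\<^sub>M lborel)"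
      by (simp add: lborel_prod)
    have "(\<integral>\<^sup>+z. indicator (cylinder T) z * cube_norm T f z \<partial>lborel) =
        (\<integral>\<^sup>+t. \<integral>\<^sup>+x. indicator (cylinder T) (x, t) * cube_norm T f (x, t) \<partial>lborel \<partial>lborel)"
      by (subst lborel_prod[symmetric], subst lborel_pair.nn_integral_snd[symmetric]) simp_all
    also have "\<dots> = (\<integral>\<^sup>+t\<in>{0<..<T}. (\<integral>\<^sup>+x\<in>torus_cell. ennreal (norm (f (x, t)) ^ 3) \<partial>lborel) \<partial>lborel)"
    proof (rule nn_integral_cong)
      fix t
      show "(\<integral>\<^sup>+x. indicator (cylinder T) (x, t) * cube_norm T f (x, t) \<partial>lborel) =
          (\<integral>\<^sup>+x\<in>torus_cell. ennreal (norm (f (x, t)) ^ 3) \<partial>lborel) * indicator {0<..<T} t"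
        by (cases "t \<in> {0<..<T}")
          (auto simp: cube_norm_def indicator_def of_bool_def intro!: nn_integral_cong)
    qed
    finally show ?thesis ..
  qed
  then show ?thesis by (auto simp: L3_L3_def)
qed

lemma cube_add_le: "(a + b) ^ 3 \<le> 4 * (a ^ 3 + b ^ 3)" if "0 \<le> a" "0 \<le> b" for a b :: real
proof -
  have "4 * (a ^ 3 + b ^ 3) - (a + b) ^ 3 = 3 * (a + b) * (a - b)\<^sup>2"
    by algebra
  then show ?thesis
    using that by (smt (verit) mult_nonneg_nonneg zero_le_power2)
qed

lemma product_le_cubes:
  "a * (b * c) \<le> a ^ 3 + b ^ 3 + c ^ 3" if "0 \<le> a" "0 \<le> b" "0 \<le> c" for a b c :: real
proof -
  define m where "m = max a (max b c)"
  have "a * (b * c) \<le> m * (m * m)"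
    using that by (intro mult_mono) (auto simp: m_def)
  also have "\<dots> = m ^ 3" by (simp add: power3_eq_cube)
  also have "\<dots> \<le> a ^ 3 + b ^ 3 + c ^ 3"
    using that by (auto simp: m_def max_def)
  finally show ?thesis .
qed

lemma L3_L3_linear_combination:
  assumes f: "f \<in> L3_L3 T" and g: "g \<in> L3_L3 T"
  shows "(\<lambda>z. a *\<^sub>R f z + b *\<^sub>R g z) \<in> L3_L3 T"
proof -
  have F: "torus_field T f" "torus_field T g" using f g by (auto simp: L3_L3_iff)
  have field: "torus_field T (\<lambda>z. a *\<^sub>R f z + b *\<^sub>R g z)"
    using F by (auto simp: torus_field_def periodic_on_def)
  note [measurable] = cube_norm_measurable[OF F(1)] cube_norm_measurable[OF F(2)]
  let ?k = "\<lambda>c. ennreal (4 * \<bar>c\<bar> ^ 3)"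
  let ?I = "indicator (cylinder T) :: _ \<Rightarrow> ennreal"
  have "cube_norm T (\<lambda>z. a *\<^sub>R f z + b *\<^sub>R g z) z \<le>
      ?k a * cube_norm T f z + ?k b * cube_norm T g z" for z
  proof (cases "z \<in> UNIV \<times> {0<..<T}")
    case True
    have "norm (a *\<^sub>R f z + b *\<^sub>R g z) ^ 3 \<le> (\<bar>a\<bar> * norm (f z) + \<bar>b\<bar> * norm (g z)) ^ 3"
      by (intro power_mono) (use norm_triangle_ineq[of "a *\<^sub>R f z" "b *\<^sub>R g z"] in auto)
    also have "\<dots> \<le> 4 * \<bar>a\<bar> ^ 3 * norm (f z) ^ 3 + 4 * \<bar>b\<bar> ^ 3 * norm (g z) ^ 3"
      using cube_add_le[of "\<bar>a\<bar> * norm (f z)" "\<bar>b\<bar> * norm (g z)"] by (simp add: power_mult_distrib)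
    finally show ?thesis
      using True by (simp add: cube_norm_def ennreal_mult[symmetric] ennreal_plus[symmetric] ennreal_leI del: ennreal_plus)
  qed (auto simp: cube_norm_def)
  then have "?I z * cube_norm T (\<lambda>z. a *\<^sub>R f z + b *\<^sub>R g z) z \<le>
      ?k a * (?I z * cube_norm T f z) + ?k b * (?I z * cube_norm T g z)" for z
    by (auto simp: indicator_def)
  then have "(\<integral>\<^sup>+z. ?I z * cube_norm T (\<lambda>z. a *\<^sub>R f z + b *\<^sub>R g z) z \<partial>lborel) \<le>
      (\<integral>\<^sup>+z. ?k a * (?I z * cube_norm T f z) + ?k b * (?I z * cube_norm T g z) \<partial>lborel)"
    by (rule nn_integral_mono)
  also have "\<dots> = ?k a * (\<integral>\<^sup>+z. ?I z * cube_norm T f z \<partial>lborel) +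
      ?k b * (\<integral>\<^sup>+z. ?I z * cube_norm T g z \<partial>lborel)"
    by (subst nn_integral_add) (simp_all add: nn_integral_cmult)
  also have "\<dots> < \<infinity>"
    using f g by (simp add: L3_L3_iff ennreal_mult_less_top)
  finally show ?thesis
    using field by (simp add: L3_L3_iff)
qed

text \<open>
  The 27 lattice vectors whose translates of the fundamental cell cover its unit neighbourhood.
\<close>

definition unit_shifts :: "(real^3) set" where
  "unit_shifts = (\<lambda>k. \<chi> i. k i) ` (UNIV \<rightarrow>\<^sub>E {-1, 0, 1})"

lemma finite_unit_shifts: "finite unit_shifts"
  unfolding unit_shifts_def by (intro finite_imageI finite_PiE) auto

lemma periodic_unit_shift:
  assumes f: "periodic_on T f" and k: "k \<in> unit_shifts" and t: "t \<in> {0<..<T}"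
  shows "f (x + k, t) = f (x, t)"
proof -
  have shift: "f (x + c *\<^sub>R axis i 1, t) = f (x, t)" if "c \<in> {-1, 0, 1}" for x i and c :: real
  proof -
    have p: "f (y + axis i 1, t) = f (y, t)" for y
      using f t unfolding periodic_on_def by blast
    show ?thesis
      using that p[of x] p[of "x - axis i 1"] by auto
  qed
  have comp: "k $ i \<in> {-1, 0, 1}" for i
    using k by (auto simp: unit_shifts_def PiE_def Pi_def)
  have "x + k = x + (k $ 1) *\<^sub>R axis 1 1 + (k $ 2) *\<^sub>R axis 2 1 + (k $ 3) *\<^sub>R axis 3 1"
    by (auto simp: vec_eq_iff axis_def forall_3)
  then show ?thesis
    by (simp only: shift[OF comp])
qed

lemma torus_cell_shift_cover:
  assumes "x \<in> torus_cell" "norm l \<le> 1"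
  shows "\<exists>k\<in>unit_shifts. x + l + k \<in> torus_cell"
proof -
  define k :: "3 \<Rightarrow> real" where
    "k i = (if (x + l) $ i > 1 / 2 then -1 else if (x + l) $ i < - 1 / 2 then 1 else 0)" for i
  have "(\<chi> i. k i) \<in> unit_shifts"
    unfolding unit_shifts_def by (intro imageI) (auto simp: PiE_iff k_def)
  moreover have "x + l + (\<chi> i. k i) \<in> torus_cell"
  proof -
    have "- (1 / 2) \<le> x $ i + l $ i + k i \<and> x $ i + l $ i + k i \<le> 1 / 2" for i
    proof -
      have "\<bar>l $ i\<bar> \<le> 1"
        using component_le_norm_cart[of l i] assms(2) by linarith
      moreover have "- (1 / 2) \<le> x $ i" "x $ i \<le> 1 / 2"
        using assms(1) by (simp_all add: torus_cell_def mem_box_cart)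
      ultimately show ?thesis
        unfolding k_def vector_add_component
        by (cases "x $ i + l $ i > 1 / 2"; cases "x $ i + l $ i < - 1 / 2"; simp only: if_True if_False; linarith)
    qed
    then show ?thesis
      unfolding torus_cell_def mem_box_cart vector_add_component vec_lambda_beta
      by (metis divide_minus_left)
  qed
  ultimately show ?thesis by blast
qed

lemma nn_integral_lborel_translate:
  fixes F :: "'a::euclidean_space \<Rightarrow> ennreal"
  assumes "F \<in> borel_measurable borel"
  shows "(\<integral>\<^sup>+z. F (z + c) \<partial>lborel) = (\<integral>\<^sup>+z. F z \<partial>lborel)"
proof -
  have "(\<integral>\<^sup>+z. F z \<partial>lborel) = (\<integral>\<^sup>+z. F z \<partial>distr lborel borel ((+) c))"
    by (simp add: lborel_distr_plus)
  also have "\<dots> = (\<integral>\<^sup>+z. F (z + c) \<partial>lborel)"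
    using assms by (subst nn_integral_distr) (simp_all add: add.commute)
  finally show ?thesis ..
qed

text \<open>
  A crude substitute for translation invariance of integrals over a period: the shifted cell is
  covered by finitely many lattice translates of the cell, and each contributes the same integral.
\<close>

lemma nn_integral_shifted_cell:
  assumes f: "torus_field T f" and l: "norm l \<le> 1"
  shows "(\<integral>\<^sup>+z. indicator (cylinder T) z * cube_norm T f (z + (l, 0)) \<partial>lborel) \<le>
    of_nat (card unit_shifts) * (\<integral>\<^sup>+z. indicator (cylinder T) z * cube_norm T f z \<partial>lborel)"
proof -
  note [measurable] = cube_norm_measurable[OF f]
  define G where "G z = indicator (cylinder T) z * cube_norm T f z" for z
  have G[measurable]: "G \<in> borel_measurable borel"
    unfolding G_def by measurable
  have pt: "indicator (cylinder T) z * cube_norm T f (z + (l, 0)) \<le> (\<Sum>k\<in>unit_shifts. G (z + (l + k, 0)))" for z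
  proof (cases "z \<in> cylinder T")
    case True
    then obtain x t where z: "z = (x, t)" "x \<in> torus_cell" "t \<in> {0<..<T}" by auto
    obtain k where k: "k \<in> unit_shifts" "x + l + k \<in> torus_cell"
      using torus_cell_shift_cover[OF z(2) l] by blast
    have "f (x + l + k, t) = f (x + l, t)"
      using f z(3) k(1) by (intro periodic_unit_shift) (auto simp: torus_field_def)
    then have "indicator (cylinder T) z * cube_norm T f (z + (l, 0)) = G (z + (l + k, 0))"
      using z k by (simp add: G_def cube_norm_def indicator_def add.assoc)
    also have "\<dots> \<le> (\<Sum>k\<in>unit_shifts. G (z + (l + k, 0)))"
      by (rule member_le_sum[OF k(1)]) (simp_all add: finite_unit_shifts)
    finally show ?thesis .
  qed simp
  have "(\<integral>\<^sup>+z. indicator (cylinder T) z * cube_norm T f (z + (l, 0)) \<partial>lborel) \<le>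
      (\<integral>\<^sup>+z. (\<Sum>k\<in>unit_shifts. G (z + (l + k, 0))) \<partial>lborel)"
    by (intro nn_integral_mono pt)
  also have "\<dots> = (\<Sum>k\<in>unit_shifts. \<integral>\<^sup>+z. G (z + (l + k, 0)) \<partial>lborel)"
    by (rule nn_integral_sum) measurable
  also have "\<dots> = of_nat (card unit_shifts) * (\<integral>\<^sup>+z. G z \<partial>lborel)"
    by (simp add: nn_integral_lborel_translate[OF G])
  finally show ?thesis by (simp add: G_def)
qed

lemma increment_cube_bound:
  assumes "f \<in> L3_L3 T"
  obtains C :: real where "C \<ge> 0" "\<And>l. norm l \<le> 1 \<Longrightarrow>
    (\<integral>\<^sup>+z. indicator (cylinder T) z * ennreal (norm (incr f l z) ^ 3) \<partial>lborel) \<le> ennreal C"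
proof -
  have f: "torus_field T f" using assms by (simp add: L3_L3_iff)
  note [measurable] = cube_norm_measurable[OF f]
  let ?I = "indicator (cylinder T) :: _ \<Rightarrow> ennreal"
  define N where "N = (\<integral>\<^sup>+z. ?I z * cube_norm T f z \<partial>lborel)"
  have "N < \<infinity>" using assms by (simp add: L3_L3_iff N_def)
  then have fin: "4 * (of_nat (card unit_shifts) * N + N) < \<infinity>"
    using of_nat_less_top[of "card unit_shifts"] by (simp add: ennreal_mult_less_top)
  have "(\<integral>\<^sup>+z. ?I z * ennreal (norm (incr f l z) ^ 3) \<partial>lborel) \<le> 4 * (of_nat (card unit_shifts) * N + N)"
    if l: "norm l \<le> 1" for l
  proof -
    have pt: "?I z * ennreal (norm (incr f l z) ^ 3) \<le>
        4 * (?I z * cube_norm T f (z + (l, 0)) + ?I z * cube_norm T f z)" for z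
    proof (cases "z \<in> cylinder T")
      case True
      then obtain x t where z: "z = (x, t)" "x \<in> torus_cell" "t \<in> {0<..<T}" by auto
      have "norm (incr f l z) ^ 3 \<le> (norm (f (x + l, t)) + norm (f (x, t))) ^ 3"
        using z by (intro power_mono) (auto simp: incr_def norm_triangle_ineq4)
      also have "\<dots> \<le> 4 * (norm (f (x + l, t)) ^ 3 + norm (f (x, t)) ^ 3)"
        by (rule cube_add_le) auto
      finally have "ennreal (norm (incr f l z) ^ 3) \<le> ennreal (4 * (norm (f (x + l, t)) ^ 3 + norm (f (x, t)) ^ 3))"
        by (rule ennreal_leI)
      then show ?thesis
        using z by (simp add: cube_norm_def ennreal_mult)
    qed simp
    have "(\<integral>\<^sup>+z. ?I z * ennreal (norm (incr f l z) ^ 3) \<partial>lborel) \<le>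
        (\<integral>\<^sup>+z. 4 * (?I z * cube_norm T f (z + (l, 0)) + ?I z * cube_norm T f z) \<partial>lborel)"
      by (intro nn_integral_mono pt)
    also have "\<dots> = 4 * (\<integral>\<^sup>+z. ?I z * cube_norm T f (z + (l, 0)) + ?I z * cube_norm T f z \<partial>lborel)"
      by (rule nn_integral_cmult) measurable
    also have "(\<integral>\<^sup>+z. ?I z * cube_norm T f (z + (l, 0)) + ?I z * cube_norm T f z \<partial>lborel) =
        (\<integral>\<^sup>+z. ?I z * cube_norm T f (z + (l, 0)) \<partial>lborel) + N"
      unfolding N_def by (rule nn_integral_add) measurable
    also have "4 * ((\<integral>\<^sup>+z. ?I z * cube_norm T f (z + (l, 0)) \<partial>lborel) + N) \<le>
        4 * (of_nat (card unit_shifts) * N + N)"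
      unfolding N_def by (intro mult_left_mono add_right_mono nn_integral_shifted_cell f l) simp
    finally show ?thesis .
  qed
  moreover obtain C where "C \<ge> 0" "4 * (of_nat (card unit_shifts) * N + N) = ennreal C"
    using fin by (auto simp only: less_top_ennreal infinity_ennreal_def)
  ultimately show ?thesis
    by (intro that[of C]) auto
qed

text \<open>
  The flux whose sphere average is the structure function of the three fields; the first field is the
  one contracted with the displacement.
\<close>

definition trilinear_flux ::
    "(spacetime \<Rightarrow> real^3) \<Rightarrow> (spacetime \<Rightarrow> real^3) \<Rightarrow> (spacetime \<Rightarrow> real^3) \<Rightarrow>
     real^3 \<Rightarrow> spacetime \<Rightarrow> real^3" where
  "trilinear_flux f g k l z = (incr g l z \<bullet> incr k l z) *\<^sub>R incr f l z"

lemma increment_measurable: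
  assumes "torus_field T f"
  shows "(\<lambda>p. indicator (cylinder T) (snd p) *\<^sub>R incr f (fst p) (snd p)) \<in>
    borel_measurable (borel :: ((real^3) \<times> spacetime) measure)"
proof -
  define g where "g z = indicator (UNIV \<times> {0<..<T}) z *\<^sub>R f z" for z
  have [measurable]: "g \<in> borel_measurable (borel \<Otimes>\<^sub>M borel)"
    using torus_field_measurable[OF assms] by (simp add: g_def[abs_def] borel_prod)
  have [measurable]: "cylinder T \<in> sets (borel \<Otimes>\<^sub>M borel)"
    by (simp add: borel_prod)
  have "(\<lambda>p. indicator (cylinder T) (snd p) *\<^sub>R incr f (fst p) (snd p)) =
      (\<lambda>p. indicator (cylinder T) (snd p) *\<^sub>R
        (g (fst (snd p) + fst p, snd (snd p)) - g (fst (snd p), snd (snd p))))"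
    by (auto simp: fun_eq_iff incr_def g_def indicator_def)
  also have "\<dots> \<in> borel_measurable (borel \<Otimes>\<^sub>M (borel \<Otimes>\<^sub>M borel))"
    by measurable
  finally show ?thesis
    by (simp add: borel_prod)
qed

text \<open>
  The product of three increments is dominated by the sum of their cubes.
\<close>

lemma integrable_trilinear_flux:
  assumes "f \<in> L3_L3 T" "g \<in> L3_L3 T" "k \<in> L3_L3 T"
  shows "integrable_flux T (trilinear_flux f g k)"
proof -
  let ?I = "indicator (cylinder T) :: _ \<Rightarrow> ennreal"
  have field: "torus_field T f" "torus_field T g" "torus_field T k"
    using assms by (auto simp: L3_L3_iff)
  note m = field[THEN increment_measurable]
  obtain A where A: "A \<ge> 0"
    "\<And>l. norm l \<le> 1 \<Longrightarrow> (\<integral>\<^sup>+z. ?I z * ennreal (norm (incr f l z) ^ 3) \<partial>lborel) \<le> ennreal A"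
    by (rule increment_cube_bound[OF assms(1)]) (rule that)
  obtain B where B: "B \<ge> 0"
    "\<And>l. norm l \<le> 1 \<Longrightarrow> (\<integral>\<^sup>+z. ?I z * ennreal (norm (incr g l z) ^ 3) \<partial>lborel) \<le> ennreal B"
    by (rule increment_cube_bound[OF assms(2)]) (rule that)
  obtain C where C: "C \<ge> 0"
    "\<And>l. norm l \<le> 1 \<Longrightarrow> (\<integral>\<^sup>+z. ?I z * ennreal (norm (incr k l z) ^ 3) \<partial>lborel) \<le> ennreal C"
    by (rule increment_cube_bound[OF assms(3)]) (rule that)
  have slice: "(\<lambda>z. ?I z * ennreal (norm (incr q l z) ^ 3)) \<in> borel_measurable lborel"
    if "torus_field T q" for q l
  proof -
    define g where "g z = indicator (cylinder T) z *\<^sub>R incr q l z" for z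
    have [measurable]: "g \<in> borel_measurable borel"
      using measurable_Pair2[of "\<lambda>p. indicator (cylinder T) (snd p) *\<^sub>R incr q (fst p) (snd p)" borel borel borel l]
        increment_measurable[OF that] by (simp add: borel_prod g_def[abs_def])
    have "(\<lambda>z. ennreal (norm (g z) ^ 3)) \<in> borel_measurable borel"
      by measurable
    also have "(\<lambda>z. ennreal (norm (g z) ^ 3)) = (\<lambda>z. ?I z * ennreal (norm (incr q l z) ^ 3))"
      by (auto simp: fun_eq_iff g_def indicator_def)
    finally show ?thesis by simp
  qed
  have "(\<integral>\<^sup>+z. ennreal (norm (indicator (cylinder T) z *\<^sub>R trilinear_flux f g k l z)) \<partial>lborel) \<le>
      ennreal (A + B + C)" if l: "norm l \<le> 1" for l
  proof -
    have pt: "ennreal (norm (indicator (cylinder T) z *\<^sub>R trilinear_flux f g k l z)) \<le>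
        ?I z * ennreal (norm (incr f l z) ^ 3) + ?I z * ennreal (norm (incr g l z) ^ 3) +
        ?I z * ennreal (norm (incr k l z) ^ 3)" for z
    proof (cases "z \<in> cylinder T")
      case True
      have "norm (trilinear_flux f g k l z) \<le> norm (incr f l z) * (norm (incr g l z) * norm (incr k l z))"
        unfolding trilinear_flux_def norm_scaleR
        by (subst mult.commute) (simp add: mult_left_mono Cauchy_Schwarz_ineq2)
      also have "\<dots> \<le> norm (incr f l z) ^ 3 + norm (incr g l z) ^ 3 + norm (incr k l z) ^ 3"
        by (rule product_le_cubes) auto
      finally show ?thesis
        using True by (simp add: ennreal_plus[symmetric] ennreal_leI del: ennreal_plus)
    qed simp
    have "(\<integral>\<^sup>+z. ennreal (norm (indicator (cylinder T) z *\<^sub>R trilinear_flux f g k l z)) \<partial>lborel) \<le>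
        (\<integral>\<^sup>+z. ?I z * ennreal (norm (incr f l z) ^ 3) + ?I z * ennreal (norm (incr g l z) ^ 3) +
          ?I z * ennreal (norm (incr k l z) ^ 3) \<partial>lborel)"
      by (intro nn_integral_mono pt)
    also have "\<dots> = (\<integral>\<^sup>+z. ?I z * ennreal (norm (incr f l z) ^ 3) \<partial>lborel) +
        (\<integral>\<^sup>+z. ?I z * ennreal (norm (incr g l z) ^ 3) \<partial>lborel) +
        (\<integral>\<^sup>+z. ?I z * ennreal (norm (incr k l z) ^ 3) \<partial>lborel)"
      using field[THEN slice]
      by (simp only: nn_integral_add borel_measurable_add)
    also have "\<dots> \<le> ennreal A + ennreal B + ennreal C"
      by (intro add_mono A(2) B(2) C(2) l)
    finally show ?thesis
      using A(1) B(1) C(1) by simp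
  qed
  moreover have "(\<lambda>(l, z). indicator (cylinder T) z *\<^sub>R trilinear_flux f g k l z) \<in> borel_measurable borel"
  proof -
    have "(\<lambda>(l, z). indicator (cylinder T) z *\<^sub>R trilinear_flux f g k l z) =
        (\<lambda>p. ((indicator (cylinder T) (snd p) *\<^sub>R incr g (fst p) (snd p)) \<bullet>
            (indicator (cylinder T) (snd p) *\<^sub>R incr k (fst p) (snd p))) *\<^sub>R
          (indicator (cylinder T) (snd p) *\<^sub>R incr f (fst p) (snd p)))"
      by (auto simp: fun_eq_iff trilinear_flux_def indicator_def)
    also have "\<dots> \<in> borel_measurable borel"
      by (intro borel_measurable_scaleR borel_measurable_inner m)
    finally show ?thesis .
  qed
  ultimately show ?thesis
    unfolding integrable_flux_def by blast
qed

section \<open>Distributional limits\<close>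

lemma S_avg_pairing:
  assumes "f \<in> L3_L3 T" "g \<in> L3_L3 T" "k \<in> L3_L3 T" "bounded_weight T \<psi>" "0 < r" "r \<le> 1"
  shows "pairing T (S_avg f g k r) \<psi> = sphere_mean T (trilinear_flux f g k) \<psi> r"
proof -
  have "S_avg f g k r = (\<lambda>z. - (1 / r) * (\<integral>w\<in>sphere 0 1.
      (w \<bullet> trilinear_flux f g k (r *\<^sub>R w) z) / (4 * pi) \<partial>surface_measure))"
    by (simp add: fun_eq_iff S_avg_def trilinear_flux_def mult.commute)
  then show ?thesis
    using sphere_average_pairing(2)[OF integrable_trilinear_flux[OF assms(1-3)] assms(4-6)] by simp
qed

lemma sphere_mean_limit:
  assumes "f \<in> L3_L3 T" "g \<in> L3_L3 T" "k \<in> L3_L3 T"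
    and "distr_limit T (S_avg f g k) S" "\<psi> \<in> test_functions T"
  shows "(sphere_mean T (trilinear_flux f g k) \<psi> \<longlongrightarrow> S \<psi>) (at_right 0)"
proof (rule Lim_transform_eventually)
  show "((\<lambda>r. pairing T (S_avg f g k r) \<psi>) \<longlongrightarrow> S \<psi>) (at_right 0)"
    using assms by (auto simp: distr_limit_def)
  show "\<forall>\<^sub>F r in at_right 0. pairing T (S_avg f g k r) \<psi> = sphere_mean T (trilinear_flux f g k) \<psi> r"
    using S_avg_pairing[OF assms(1-3) test_function_bounded_weight[OF assms(5)]]
    unfolding eventually_at_right_field by (intro exI[of _ 1]) auto
qed

lemma is_distribution_add:
  assumes "is_distribution T \<Lambda>" "is_distribution T \<Lambda>'"
  shows "is_distribution T (\<lambda>\<psi>. \<Lambda> \<psi> + \<Lambda>' \<psi>)"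
  unfolding is_distribution_def
proof (intro conjI ballI allI)
  fix a c assume ac: "a \<in> {0<..<T}" "c \<in> {0<..<T}"
  let ?small = "\<lambda>N \<psi> M. \<forall>es z. set es \<subseteq> Basis \<and> length es \<le> N \<longrightarrow> \<bar>iterated_partial es \<psi> z\<bar> \<le> M"
  obtain C N where 1: "\<And>\<psi> M. \<psi> \<in> smooth_supported a c \<Longrightarrow> ?small N \<psi> M \<Longrightarrow> \<bar>\<Lambda> \<psi>\<bar> \<le> C * M"
    using assms(1) ac unfolding is_distribution_def by metis
  obtain C' N' where 2: "\<And>\<psi> M. \<psi> \<in> smooth_supported a c \<Longrightarrow> ?small N' \<psi> M \<Longrightarrow> \<bar>\<Lambda>' \<psi>\<bar> \<le> C' * M"
    using assms(2) ac unfolding is_distribution_def by metis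
  have "\<bar>\<Lambda> \<psi> + \<Lambda>' \<psi>\<bar> \<le> (C + C') * M"
    if "\<psi> \<in> smooth_supported a c" "?small (max N N') \<psi> M" for \<psi> M
  proof -
    have "?small N \<psi> M" "?small N' \<psi> M"
      using that(2) by (meson max.coboundedI1 max.coboundedI2)+
    then have "\<bar>\<Lambda> \<psi>\<bar> \<le> C * M" "\<bar>\<Lambda>' \<psi>\<bar> \<le> C' * M"
      using 1 2 that(1) by blast+
    then show ?thesis
      unfolding distrib_right by linarith
  qed
  then show "\<exists>C N. \<forall>\<psi>\<in>smooth_supported a c. \<forall>M. ?small N \<psi> M \<longrightarrow> \<bar>\<Lambda> \<psi> + \<Lambda>' \<psi>\<bar> \<le> C * M"
    by blast
qed (use assms in \<open>auto simp: is_distribution_def distrib_left\<close>)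

lemma is_distribution_cmult:
  assumes "is_distribution T \<Lambda>"
  shows "is_distribution T (\<lambda>\<psi>. q * \<Lambda> \<psi>)"
  unfolding is_distribution_def
proof (intro conjI ballI allI)
  fix a c assume ac: "a \<in> {0<..<T}" "c \<in> {0<..<T}"
  let ?small = "\<lambda>N \<psi> M. \<forall>es z. set es \<subseteq> Basis \<and> length es \<le> N \<longrightarrow> \<bar>iterated_partial es \<psi> z\<bar> \<le> M"
  obtain C N where 1: "\<And>\<psi> M. \<psi> \<in> smooth_supported a c \<Longrightarrow> ?small N \<psi> M \<Longrightarrow> \<bar>\<Lambda> \<psi>\<bar> \<le> C * M"
    using assms(1) ac unfolding is_distribution_def by metis
  have "\<bar>q * \<Lambda> \<psi>\<bar> \<le> (\<bar>q\<bar> * C) * M" if "\<psi> \<in> smooth_supported a c" "?small N \<psi> M" for \<psi> M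
    using mult_left_mono[OF 1[OF that], of "\<bar>q\<bar>"] by (simp add: abs_mult mult.assoc)
  then show "\<exists>C N. \<forall>\<psi>\<in>smooth_supported a c. \<forall>M. ?small N \<psi> M \<longrightarrow> \<bar>q * \<Lambda> \<psi>\<bar> \<le> C * M"
    by blast
qed (use assms in \<open>auto simp: is_distribution_def distrib_left\<close>)

text \<open>
  The limit distribution of the mollified flux is not constructed from the flux itself: it is 3 times
  the limit of the sphere means, and inherits continuity on test functions from it.
\<close>

lemma distr_limit_mollified_flux:
  assumes V: "integrable_flux T V" and \<Lambda>: "is_distribution T \<Lambda>"
    and lim: "\<And>\<psi>. \<psi> \<in> test_functions T \<Longrightarrow> (sphere_mean T V \<psi> \<longlongrightarrow> \<Lambda> \<psi>) (at_right 0)"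
  shows "distr_limit T (mollified_flux V) (\<lambda>\<psi>. 3 * \<Lambda> \<psi>)"
  unfolding distr_limit_def
proof (intro conjI ballI)
  show "is_distribution T (\<lambda>\<psi>. 3 * \<Lambda> \<psi>)"
    by (rule is_distribution_cmult[OF \<Lambda>])
  show "\<forall>\<^sub>F \<epsilon> in at_right 0. \<forall>\<psi>\<in>test_functions T.
      set_integrable lborel (cylinder T) (\<lambda>z. mollified_flux V \<epsilon> z * \<psi> z)"
    unfolding eventually_at_right_field
    using mollified_flux_pairing(1)[OF V test_function_bounded_weight] by (intro exI[of _ "1 / 2"]) auto
  show "((\<lambda>\<epsilon>. pairing T (mollified_flux V \<epsilon>) \<psi>) \<longlongrightarrow> 3 * \<Lambda> \<psi>) (at_right 0)"
    if "\<psi> \<in> test_functions T" for \<psi>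
    by (rule mollified_flux_limit[OF V test_function_bounded_weight[OF that] lim[OF that]])
qed

lemma distr_limit_linear_combination:
  assumes F: "distr_limit T F \<Lambda>" and G: "distr_limit T G \<Lambda>'"
  shows "distr_limit T (\<lambda>\<epsilon> z. a * F \<epsilon> z + b * G \<epsilon> z) (\<lambda>\<psi>. a * \<Lambda> \<psi> + b * \<Lambda>' \<psi>)"
  unfolding distr_limit_def
proof (intro conjI ballI)
  let ?int = "\<lambda>F \<epsilon>. \<forall>\<psi>\<in>test_functions T. set_integrable lborel (cylinder T) (\<lambda>z. F \<epsilon> z * \<psi> z)"
  show "is_distribution T (\<lambda>\<psi>. a * \<Lambda> \<psi> + b * \<Lambda>' \<psi>)"
    using F G by (intro is_distribution_add is_distribution_cmult) (auto simp: distr_limit_def)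
  have ev: "\<forall>\<^sub>F \<epsilon> in at_right 0. ?int F \<epsilon> \<and> ?int G \<epsilon>"
    using F G by (auto simp: distr_limit_def eventually_conj_iff)
  then show "\<forall>\<^sub>F \<epsilon> in at_right 0. ?int (\<lambda>\<epsilon> z. a * F \<epsilon> z + b * G \<epsilon> z) \<epsilon>"
    by (rule eventually_mono)
      (auto simp: distrib_right mult.assoc intro!: set_integral_add set_integrable_mult_right)
  fix \<psi> assume \<psi>: "\<psi> \<in> test_functions T"
  show "((\<lambda>\<epsilon>. pairing T (\<lambda>z. a * F \<epsilon> z + b * G \<epsilon> z) \<psi>) \<longlongrightarrow> a * \<Lambda> \<psi> + b * \<Lambda>' \<psi>) (at_right 0)"
  proof (rule Lim_transform_eventually)
    show "((\<lambda>\<epsilon>. a * pairing T (F \<epsilon>) \<psi> + b * pairing T (G \<epsilon>) \<psi>) \<longlongrightarrow> a * \<Lambda> \<psi> + b * \<Lambda>' \<psi>) (at_right 0)"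
      using F G \<psi> by (auto simp: distr_limit_def intro!: tendsto_intros)
    show "\<forall>\<^sub>F \<epsilon> in at_right 0. a * pairing T (F \<epsilon>) \<psi> + b * pairing T (G \<epsilon>) \<psi> =
        pairing T (\<lambda>z. a * F \<epsilon> z + b * G \<epsilon> z) \<psi>"
      using ev
    proof eventually_elim
      case (elim \<epsilon>)
      then show ?case
        using \<psi> by (simp add: pairing_def distrib_right mult.assoc set_integral_add)
    qed
  qed
qed

theorem corollary1p3:
  fixes T :: real
    and v b u h :: "spacetime \<Rightarrow> real^3"
    and P S1 S2 S3 S4 S5 S6 :: "(spacetime \<Rightarrow> real) \<Rightarrow> real"
  assumes "T > 0"
    and "u = (\<lambda>z. v z + b z)" and "h = (\<lambda>z. v z - b z)"
    and "u \<in> Linf_L2 T \<inter> L3_L3 T" and "h \<in> Linf_L2 T \<inter> L3_L3 T"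
    and "weak_solution T u h P"
    and "distr_limit T (S_avg v v v) S1"
    and "distr_limit T (S_avg v b b) S2"
    and "distr_limit T (S_avg b v b) S3"
    and "distr_limit T (S_avg v v b) S4"
    and "distr_limit T (S_avg b v v) S5"
    and "distr_limit T (S_avg b b b) S6"
  shows "\<exists>D_E D_CH. distr_limit T (D_E_eps v b) D_E \<and> distr_limit T (D_CH_eps v b) D_CH \<and>
    (\<forall>\<psi>\<in>test_functions T. S1 \<psi> + S2 \<psi> - 2 * S3 \<psi> = - (4/3) * D_E \<psi>) \<and>
    (\<forall>\<psi>\<in>test_functions T. 2 * S4 \<psi> - S5 \<psi> - S6 \<psi> = - (4/3) * D_CH \<psi>)"
proof -
  \<comment> \<open>The hypotheses bound the Elsasser fields, so \<open>v\<close> and \<open>b\<close> are recovered as half sum and half difference.\<close>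
  have v_eq: "v = (\<lambda>z. (1/2) *\<^sub>R u z + (1/2) *\<^sub>R h z)" and b_eq: "b = (\<lambda>z. (1/2) *\<^sub>R u z + (-1/2) *\<^sub>R h z)"
    unfolding assms(2,3) by (simp_all add: fun_eq_iff vec_eq_iff field_simps)
  have v: "v \<in> L3_L3 T" and b: "b \<in> L3_L3 T"
    using L3_L3_linear_combination[of u T h] assms(4,5) unfolding v_eq b_eq by blast+
  \<comment> \<open>The two quadratic terms \<open>|\<delta>v|\<^sup>2\<close> and \<open>|\<delta>b|\<^sup>2\<close> share one integral in \<open>D_E\<close> and \<open>D_CH\<close>;
    they are separated only after pairing, where every integral exists.\<close>
  have pair: "distr_limit T (mollified_flux (\<lambda>l z. trilinear_flux p v v l z + trilinear_flux p b b l z))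
      (\<lambda>\<psi>. 3 * (S \<psi> + S' \<psi>))"
    if p: "p \<in> L3_L3 T" and S: "distr_limit T (S_avg p v v) S" "distr_limit T (S_avg p b b) S'" for p S S'
  proof (rule distr_limit_mollified_flux)
    note I = integrable_trilinear_flux[OF p v v] integrable_trilinear_flux[OF p b b]
    show "integrable_flux T (\<lambda>l z. trilinear_flux p v v l z + trilinear_flux p b b l z)"
      by (rule integrable_flux_add[OF I])
    show "is_distribution T (\<lambda>\<psi>. S \<psi> + S' \<psi>)"
      using S by (intro is_distribution_add) (auto simp: distr_limit_def)
    fix \<psi> assume \<psi>: "\<psi> \<in> test_functions T"
    show "(sphere_mean T (\<lambda>l z. trilinear_flux p v v l z + trilinear_flux p b b l z) \<psi> \<longlongrightarrow>
        S \<psi> + S' \<psi>) (at_right 0)"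
    proof (rule Lim_transform_eventually)
      show "((\<lambda>r. sphere_mean T (trilinear_flux p v v) \<psi> r + sphere_mean T (trilinear_flux p b b) \<psi> r)
          \<longlongrightarrow> S \<psi> + S' \<psi>) (at_right 0)"
        by (intro tendsto_add sphere_mean_limit p v b S \<psi>)
      show "\<forall>\<^sub>F r in at_right 0. sphere_mean T (trilinear_flux p v v) \<psi> r + sphere_mean T (trilinear_flux p b b) \<psi> r =
          sphere_mean T (\<lambda>l z. trilinear_flux p v v l z + trilinear_flux p b b l z) \<psi> r"
        using sphere_mean_add[OF I test_function_bounded_weight[OF \<psi>]]
        unfolding eventually_at_right_field by (intro exI[of _ 1]) auto
    qed
  qed
  have single: "distr_limit T (mollified_flux (trilinear_flux p v b)) (\<lambda>\<psi>. 3 * S \<psi>)"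
    if p: "p \<in> L3_L3 T" and S: "distr_limit T (S_avg p v b) S" for p S
    using S by (intro distr_limit_mollified_flux integrable_trilinear_flux sphere_mean_limit p v b)
      (auto simp: distr_limit_def)
  have E: "D_E_eps v b = (\<lambda>\<epsilon> z.
      - (1/4) * mollified_flux (\<lambda>l z. trilinear_flux v v v l z + trilinear_flux v b b l z) \<epsilon> z +
      (1/2) * mollified_flux (trilinear_flux b v b) \<epsilon> z)"
    by (simp add: fun_eq_iff D_E_eps_def mollified_flux_def trilinear_flux_def power2_norm_eq_inner
        inner_add_right distrib_left mult.commute)
  have CH: "D_CH_eps v b = (\<lambda>\<epsilon> z. - (1/2) * mollified_flux (trilinear_flux v v b) \<epsilon> z +
      (1/4) * mollified_flux (\<lambda>l z. trilinear_flux b v v l z + trilinear_flux b b b l z) \<epsilon> z)"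
    by (simp add: fun_eq_iff D_CH_eps_def mollified_flux_def trilinear_flux_def power2_norm_eq_inner
        inner_add_right distrib_left mult.commute)
  have "distr_limit T (D_E_eps v b) (\<lambda>\<psi>. - (1/4) * (3 * (S1 \<psi> + S2 \<psi>)) + (1/2) * (3 * S3 \<psi>))"
    unfolding E by (intro distr_limit_linear_combination pair single v b assms)
  moreover have "distr_limit T (D_CH_eps v b) (\<lambda>\<psi>. - (1/2) * (3 * S4 \<psi>) + (1/4) * (3 * (S5 \<psi> + S6 \<psi>)))"
    unfolding CH by (intro distr_limit_linear_combination pair single v b assms)
  ultimately show ?thesis
    by (intro exI conjI ballI) (assumption, assumption, simp_all add: field_simps)
qed

end
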